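(* Let $u\in L^\infty(\mathbb R)$ and $f\in L^2_{\mathrm{loc}}(\mathbb R)$ satisfy \[ (-\Delta)^{1/4}u=f\quad\text{in }\mathcal S'(\mathbb R). \] Then $u\in H^{1/2}_{\mathrm{loc}}(\mathbb R)$. More precisely, for every $\chi\in C_c^\infty(\mathbb R)$ there is a constant $C_\chi$, depending only on $\chi$, such that \[ \|\chi u\|_{H^{1/2}(\mathbb R)}\le C_\chi\left(\|\chi f\|_{L^2(\mathbb R)}+\|u\|_{L^\infty(\mathbb R)}\right). \]
   Context: $(-\Delta)^{1/4}$ is the fractional Laplacian on $\mathbb R$ with Fourier multiplier $|\xi|^{1/2}$, defined on bounded $u$ by $\langle(-\Delta)^{1/4}u,\phi\rangle=\int_{\mathbb R}u\,(-\Delta)^{1/4}\phi\,dx$ for Schwartz $\phi$. *)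

theory Defs
  imports "HOL-Probability.Probability"
begin

text \<open>
  All function spaces consist of complex-valued functions on the real line. Elements of Lebesgue
  spaces are represented by Borel functions; every class contains one.
\<close>

definition nth_deriv :: "nat \<Rightarrow> (real \<Rightarrow> complex) \<Rightarrow> real \<Rightarrow> complex" where
  "nth_deriv n \<phi> = ((\<lambda>g x. vector_derivative g (at x)) ^^ n) \<phi>"

definition smooth :: "(real \<Rightarrow> complex) \<Rightarrow> bool" where
  "smooth \<phi> \<longleftrightarrow> (\<forall>n x. nth_deriv n \<phi> differentiable (at x))"

definition schwartz :: "(real \<Rightarrow> complex) \<Rightarrow> bool" where
  "schwartz \<phi> \<longleftrightarrow>
     smooth \<phi> \<and> (\<forall>k n. bounded (range (\<lambda>x. x ^ k *\<^sub>R nth_deriv n \<phi> x)))"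

definition test_fun :: "(real \<Rightarrow> complex) \<Rightarrow> bool" where
  "test_fun \<phi> \<longleftrightarrow> smooth \<phi> \<and> compact (closure {x. \<phi> x \<noteq> 0})"

definition in_L2 :: "(real \<Rightarrow> complex) \<Rightarrow> bool" where
  "in_L2 v \<longleftrightarrow> v \<in> borel_measurable lborel \<and> integrable lborel (\<lambda>x. (cmod (v x))\<^sup>2)"

definition L2_norm :: "(real \<Rightarrow> complex) \<Rightarrow> real" where
  "L2_norm v = sqrt (\<integral>x. (cmod (v x))\<^sup>2 \<partial>lborel)"

definition in_L2_loc :: "(real \<Rightarrow> complex) \<Rightarrow> bool" where
  "in_L2_loc v \<longleftrightarrow> v \<in> borel_measurable lborel \<and>
     (\<forall>K. compact K \<longrightarrow> set_integrable lborel K (\<lambda>x. (cmod (v x))\<^sup>2))"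

definition in_Linf :: "(real \<Rightarrow> complex) \<Rightarrow> bool" where
  "in_Linf v \<longleftrightarrow> v \<in> borel_measurable lborel \<and> esssup lborel (\<lambda>x. ereal (cmod (v x))) < \<infinity>"

definition Linf_norm :: "(real \<Rightarrow> complex) \<Rightarrow> real" where
  "Linf_norm v = real_of_ereal (esssup lborel (\<lambda>x. ereal (cmod (v x))))"

text \<open>
  The Fourier transform is taken in angular frequency, so that the negative Laplacian has
  multiplier \<open>\<bar>\<xi>\<bar>\<^sup>2\<close>. The integrals converge absolutely for integrable arguments.
\<close>

definition fourier :: "(real \<Rightarrow> complex) \<Rightarrow> real \<Rightarrow> complex" where
  "fourier \<phi> \<xi> = (\<integral>x. cis (- (x * \<xi>)) * \<phi> x \<partial>lborel)"

definition inv_fourier :: "(real \<Rightarrow> complex) \<Rightarrow> real \<Rightarrow> complex" where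
  "inv_fourier \<psi> x = (\<integral>\<xi>. cis (x * \<xi>) * \<psi> \<xi> \<partial>lborel) / complex_of_real (2 * pi)"

text \<open>The operator \<open>(-\<Delta>)\<^sup>s\<close> on Schwartz functions, for \<open>s > 0\<close>.\<close>

definition frac_laplacian :: "real \<Rightarrow> (real \<Rightarrow> complex) \<Rightarrow> real \<Rightarrow> complex" where
  "frac_laplacian s \<phi> =
     inv_fourier (\<lambda>\<xi>. complex_of_real (\<bar>\<xi>\<bar> powr (2 * s)) * fourier \<phi> \<xi>)"

text \<open>
  The distribution \<open>(-\<Delta>)\<^sup>s u\<close> for bounded \<open>u\<close>, as a functional on Schwartz functions. The
  pairing is bilinear, without complex conjugation.
\<close>

definition frac_laplacian_distr ::
    "real \<Rightarrow> (real \<Rightarrow> complex) \<Rightarrow> (real \<Rightarrow> complex) \<Rightarrow> complex" where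
  "frac_laplacian_distr s u \<phi> = (\<integral>x. u x * frac_laplacian s \<phi> x \<partial>lborel)"

text \<open>
  Equality in \<open>S'\<close> of a tempered distribution \<open>T\<close> and a locally integrable function \<open>f\<close>.
  Since \<open>f\<close> may grow arbitrarily fast, \<open>f \<phi>\<close> need not be integrable for every Schwartz function
  \<open>\<phi>\<close>; the identity is required whenever it is. This includes all \<open>\<phi>\<close> of compact support,
  which are dense among Schwartz functions, so \<open>f\<close> determines \<open>T\<close>.
\<close>

definition eq_tempered :: "((real \<Rightarrow> complex) \<Rightarrow> complex) \<Rightarrow> (real \<Rightarrow> complex) \<Rightarrow> bool" where
  "eq_tempered T f \<longleftrightarrow>
     (\<forall>\<phi>. schwartz \<phi> \<longrightarrow> integrable lborel (\<lambda>x. f x * \<phi> x) \<longrightarrow>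
        T \<phi> = (\<integral>x. f x * \<phi> x \<partial>lborel))"

text \<open>
  The Fourier transform on \<open>L\<^sup>2\<close>, characterised by duality with Schwartz functions. It exists by
  Plancherel's theorem and is unique almost everywhere.
\<close>

definition fourier_L2 :: "(real \<Rightarrow> complex) \<Rightarrow> real \<Rightarrow> complex" where
  "fourier_L2 v = (SOME g. in_L2 g \<and>
     (\<forall>\<phi>. schwartz \<phi> \<longrightarrow>
        (\<integral>\<xi>. g \<xi> * \<phi> \<xi> \<partial>lborel) = (\<integral>x. v x * fourier \<phi> x \<partial>lborel)))"

text \<open>
  The Bessel potential space \<open>H\<^sup>s\<close> for \<open>s \<ge> 0\<close>. The factor \<open>1 / (2\<pi>)\<close> makes the norm
  of \<open>H\<^sup>0\<close> the \<open>L\<^sup>2\<close> norm.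
\<close>

definition in_H :: "real \<Rightarrow> (real \<Rightarrow> complex) \<Rightarrow> bool" where
  "in_H s v \<longleftrightarrow> in_L2 v \<and>
     integrable lborel (\<lambda>\<xi>. (1 + \<xi>\<^sup>2) powr s * (cmod (fourier_L2 v \<xi>))\<^sup>2)"

definition H_norm :: "real \<Rightarrow> (real \<Rightarrow> complex) \<Rightarrow> real" where
  "H_norm s v =
     sqrt ((\<integral>\<xi>. (1 + \<xi>\<^sup>2) powr s * (cmod (fourier_L2 v \<xi>))\<^sup>2 \<partial>lborel) / (2 * pi))"

definition in_H_loc :: "real \<Rightarrow> (real \<Rightarrow> complex) \<Rightarrow> bool" where
  "in_H_loc s v \<longleftrightarrow> (\<forall>\<eta>. test_fun \<eta> \<longrightarrow> in_H s (\<lambda>x. \<eta> x * v x))"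

end

theory Submission
  imports Defs
begin

text \<open>
  Write \<open>\<Lambda>\<close> for \<open>(-\<Delta>)\<^sup>1\<^sup>/\<^sup>4\<close> and \<open>v = \<eta> u\<close>. The function \<open>v\<close> is bounded with compact
  support, so its Fourier transform is an absolutely convergent integral, and what has to be shown is
  that \<open>\<bar>\<xi>\<bar>\<^sup>1\<^sup>/\<^sup>2\<close> times this transform is square integrable.

  The operator has a singular integral form: for a constant \<open>A \<noteq> 0\<close>, \<open>A \<Lambda> \<phi> x\<close> is the integral of
  \<open>(\<phi> x - \<phi> (x + h)) / \<bar>h\<bar>\<^sup>3\<^sup>/\<^sup>2\<close> over \<open>h\<close> (\<open>frac_laplacian_singular_integral\<close>). Therefore
  \<open>A (\<Lambda> (\<eta> \<psi>) - \<eta> \<Lambda> \<psi>)\<close> is an integral operator applied to \<open>\<psi>\<close>, with kernel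
  \<open>K x y = (\<eta> x - \<eta> y) / \<bar>x - y\<bar>\<^sup>3\<^sup>/\<^sup>2\<close>. The smoothness of \<open>\<eta>\<close> gains one power near the diagonal, where
  \<open>\<bar>h\<bar>\<^sup>-\<^sup>1\<^sup>/\<^sup>2\<close> is integrable; far from it \<open>\<bar>h\<bar>\<^sup>-\<^sup>3\<^sup>/\<^sup>2\<close> is integrable. Together with the compact support of
  \<open>\<eta>\<close> this makes the integral of \<open>\<bar>K x y\<bar>\<close> over \<open>x\<close> a bounded and integrable, hence square integrable,
  function of \<open>y\<close>. So \<open>E y\<close>, the integral of \<open>u x * K x y\<close> over \<open>x\<close>, has \<open>L\<^sup>2\<close> norm at most a constant
  times \<open>sup \<bar>u\<bar>\<close> (\<open>commutator_adjoint_bounded\<close>).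

  Testing the equation for \<open>u\<close> with \<open>\<eta> \<psi>\<close>, where \<open>\<psi>\<close> is a translated Gaussian, and moving the
  commutator to \<open>u\<close> yields \<open>A \<Lambda> v = h\<close> with \<open>h = A \<eta> f - E\<close>, tested with \<open>\<psi>\<close>. On the Fourier side
  translation of \<open>\<psi>\<close> is modulation, so the injectivity of the Fourier transform turns these identities
  into the equality of \<open>A \<bar>\<xi>\<bar>\<^sup>1\<^sup>/\<^sup>2\<close> times the transform of \<open>v\<close> with the transform of \<open>h\<close>
  (\<open>localised_equation\<close>). The estimate follows from the upper bound in Plancherel's theorem, applied
  to \<open>h\<close> for the high frequencies and to \<open>v\<close> for the low ones. The cutoff on both sides of the estimate
  is the same \<open>\<eta>\<close> because the commutator already has its values in \<open>L\<^sup>2\<close> of the whole line.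
\<close>

section \<open>Smooth functions and test functions\<close>

lemma nth_deriv_0 [simp]: "nth_deriv 0 f = f"
  by (simp add: nth_deriv_def)

lemma nth_deriv_Suc: "nth_deriv (Suc n) f = (\<lambda>x. vector_derivative (nth_deriv n f) (at x))"
  by (simp add: nth_deriv_def)

lemma nth_deriv_add: "nth_deriv m (nth_deriv n f) = nth_deriv (m + n) f"
  by (simp add: nth_deriv_def funpow_add)

lemma smooth_has_vector_derivative:
  assumes "smooth f"
  shows "(nth_deriv n f has_vector_derivative nth_deriv (Suc n) f x) (at x)"
  using assms by (simp add: smooth_def nth_deriv_Suc vector_derivative_works)

lemma smooth_nth_deriv: "smooth f \<Longrightarrow> smooth (nth_deriv n f)"
  by (simp add: smooth_def nth_deriv_add)

lemma smooth_continuous: "smooth f \<Longrightarrow> continuous_on A (nth_deriv n f)"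
  by (blast intro: continuous_at_imp_continuous_on has_vector_derivative_continuous
        smooth_has_vector_derivative)

text \<open>
  Smoothness speaks about all iterated derivatives. Exhibiting a set of functions that differentiation
  maps to itself proves it without a formula for the derivatives of higher order.
\<close>

lemma closed_under_derivative:
  assumes closed: "\<And>g. g \<in> S \<Longrightarrow> \<exists>g'\<in>S. \<forall>x. (g has_vector_derivative g' x) (at x)"
    and "f \<in> S"
  shows "nth_deriv n f \<in> S" and "smooth f"
proof -
  have deriv_in: "(\<lambda>x. vector_derivative g (at x)) \<in> S" if g: "g \<in> S" for g
  proof -
    obtain g' where "g' \<in> S" "\<And>x. (g has_vector_derivative g' x) (at x)"
      using closed[OF g] by blast
    moreover from this have "(\<lambda>x. vector_derivative g (at x)) = g'"
      by (auto intro!: ext vector_derivative_at)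
    ultimately show ?thesis by simp
  qed
  have in_S: "nth_deriv n f \<in> S" for n
    by (induction n) (auto simp: nth_deriv_Suc intro: \<open>f \<in> S\<close> deriv_in)
  show "nth_deriv n f \<in> S" by (rule in_S)
  show "smooth f"
    unfolding smooth_def
    using in_S closed by (meson differentiableI_vector)
qed

text \<open>
  By the product rule differentiation maps this set to itself, which takes the place of the Leibniz
  formula with its binomial coefficients.
\<close>

inductive_set sums_of_smooth_products :: "(real \<Rightarrow> complex) set" where
  prod: "\<lbrakk>smooth f; smooth g\<rbrakk> \<Longrightarrow> (\<lambda>x. f x * g x) \<in> sums_of_smooth_products"
| sum: "\<lbrakk>F \<in> sums_of_smooth_products; G \<in> sums_of_smooth_products\<rbrakk>
          \<Longrightarrow> (\<lambda>x. F x + G x) \<in> sums_of_smooth_products"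

lemma smooth_mult:
  assumes "smooth f" "smooth g"
  shows "smooth (\<lambda>x. f x * g x)"
proof (rule closed_under_derivative(2)[where S = sums_of_smooth_products])
  show "(\<lambda>x. f x * g x) \<in> sums_of_smooth_products"
    using assms by (rule sums_of_smooth_products.prod)
next
  fix F assume "F \<in> sums_of_smooth_products"
  then show "\<exists>F'\<in>sums_of_smooth_products. \<forall>x. (F has_vector_derivative F' x) (at x)"
  proof induction
    case (prod f g)
    have "\<forall>x. ((\<lambda>x. f x * g x) has_vector_derivative
             (f x * nth_deriv 1 g x + nth_deriv 1 f x * g x)) (at x)"
      using smooth_has_vector_derivative[OF prod(1), of 0] smooth_has_vector_derivative[OF prod(2), of 0]
      by (auto intro!: has_vector_derivative_mult)
    moreover have "(\<lambda>x. f x * nth_deriv 1 g x + nth_deriv 1 f x * g x) \<in> sums_of_smooth_products"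
      by (intro sums_of_smooth_products.intros prod smooth_nth_deriv)
    ultimately show ?case by (intro bexI)
  next
    case (sum F G)
    then obtain F' G' where "F' \<in> sums_of_smooth_products" "G' \<in> sums_of_smooth_products"
      "\<forall>x. (F has_vector_derivative F' x) (at x)" "\<forall>x. (G has_vector_derivative G' x) (at x)"
      by blast
    then show ?case
      by (intro bexI[of _ "\<lambda>x. F' x + G' x"])
         (auto intro!: sums_of_smooth_products.intros derivative_intros)
  qed
qed

text \<open>
  One radius serves all derivatives, because the derivative of a function that vanishes on an open set
  vanishes there.
\<close>

lemma test_fun_support:
  assumes "test_fun f"
  obtains R where "R > 0" "\<And>n x. \<bar>x\<bar> > R \<Longrightarrow> nth_deriv n f x = 0"
proof -
  have "bounded {x. f x \<noteq> 0}"
    using assms unfolding test_fun_def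
    by (meson bounded_subset closure_subset compact_imp_bounded)
  then obtain R where R: "R > 0" "\<And>x. f x \<noteq> 0 \<Longrightarrow> \<bar>x\<bar> \<le> R"
    unfolding bounded_pos by auto
  have "nth_deriv n f x = 0" if "\<bar>x\<bar> > R" for n x
    using that
  proof (induction n arbitrary: x)
    case 0
    then show ?case using R(2)[of x] by force
  next
    case (Suc n)
    have "open {y::real. \<bar>y\<bar> > R}"
      by (intro open_Collect_less continuous_intros)
    then have "(nth_deriv n f has_vector_derivative 0) (at x)"
      using Suc by (intro has_vector_derivative_transform_within_open[OF has_vector_derivative_const])
        (auto simp: Suc.IH)
    then show ?case
      unfolding nth_deriv_Suc by (rule vector_derivative_at)
  qed
  with R(1) show ?thesis using that by blast
qed

lemma bounded_range_if_compactly_supported: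
  fixes f :: "real \<Rightarrow> 'a::real_normed_vector"
  assumes "continuous_on UNIV f" "\<And>x. \<bar>x\<bar> > R \<Longrightarrow> f x = 0"
  shows "bounded (range f)"
proof -
  have "compact (f ` {-R..R})"
    by (intro compact_continuous_image continuous_on_subset[OF assms(1)]) auto
  then have "bounded (insert 0 (f ` {-R..R}))"
    by (simp add: compact_imp_bounded)
  moreover have "range f \<subseteq> insert 0 (f ` {-R..R})"
  proof safe
    fix x assume "f x \<notin> f ` {-R..R}"
    then have "\<bar>x\<bar> > R" by (cases "x \<in> {-R..R}") auto
    then show "f x = 0" by (rule assms(2))
  qed
  ultimately show ?thesis by (rule bounded_subset)
qed

lemma test_fun_bounded:
  assumes "test_fun f"
  shows "bounded (range (\<lambda>x. x ^ k *\<^sub>R nth_deriv n f x))"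
proof -
  obtain R where "\<And>n x. \<bar>x\<bar> > R \<Longrightarrow> nth_deriv n f x = 0"
    using test_fun_support[OF assms] by metis
  moreover have "continuous_on UNIV (\<lambda>x. x ^ k *\<^sub>R nth_deriv n f x)"
    using assms by (intro continuous_intros smooth_continuous) (simp add: test_fun_def)
  ultimately show ?thesis
    by (intro bounded_range_if_compactly_supported[where R = R]) auto
qed

lemma test_fun_imp_schwartz: "test_fun f \<Longrightarrow> schwartz f"
  using test_fun_bounded by (auto simp: schwartz_def test_fun_def)

text \<open>
  This is how a cutoff \<open>\<eta>\<close> makes an admissible function out of a Gaussian: the product has compact
  support, so that no growth of \<open>f\<close> can spoil the integrability of \<open>f \<eta> \<psi>\<close>.
\<close>

lemma test_fun_mult:
  assumes "test_fun f" "smooth g"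
  shows "test_fun (\<lambda>x. f x * g x)"
proof -
  have "closure {x. f x * g x \<noteq> 0} \<subseteq> closure {x. f x \<noteq> 0}"
    by (intro closure_mono) auto
  then have "compact (closure {x. f x * g x \<noteq> 0})"
    using assms(1) unfolding test_fun_def by (meson closed_closure compact_eq_bounded_closed bounded_subset)
  then show ?thesis
    using assms smooth_mult unfolding test_fun_def by blast
qed

lemma test_fun_integrable:
  assumes "test_fun f"
  shows "integrable lborel (nth_deriv n f)"
proof -
  obtain R where R: "R > 0" "\<And>n x. \<bar>x\<bar> > R \<Longrightarrow> nth_deriv n f x = 0"
    using test_fun_support[OF assms] by metis
  have "set_integrable lborel {-R..R} (nth_deriv n f)"
    using assms by (intro borel_integrable_atLeastAtMost' smooth_continuous) (simp add: test_fun_def)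
  moreover have "(\<lambda>x. indicator {-R..R} x *\<^sub>R nth_deriv n f x) = nth_deriv n f"
    using R(2)[of _ n] by (intro ext) (auto simp: indicator_def abs_le_iff not_le)
  ultimately show ?thesis unfolding set_integrable_def by simp
qed

text \<open>
  For real \<open>b\<close> this is a multiple of a translated Gaussian, for imaginary \<open>b\<close> a modulated Gaussian. The
  former are the functions with which the equation is tested, the latter identify the Fourier
  transform on \<open>L\<^sup>2\<close>.
\<close>

definition quadratic_exp :: "complex \<Rightarrow> real \<Rightarrow> complex" where
  "quadratic_exp b x = exp (b * complex_of_real x - complex_of_real (x\<^sup>2 / 2))"

lemma quadratic_exp_deriv:
  "((\<lambda>x. poly p (complex_of_real x) * quadratic_exp b x) has_vector_derivative
     poly (pderiv p + [:b, -1:] * p) (complex_of_real x) * quadratic_exp b x) (at x)"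
proof -
  have "((\<lambda>z. poly p z * exp (b * z - z\<^sup>2 / 2)) has_field_derivative
          poly (pderiv p + [:b, -1:] * p) (complex_of_real x) * exp (b * of_real x - (of_real x)\<^sup>2 / 2))
          (at (complex_of_real x))"
    by (auto intro!: derivative_eq_intros poly_DERIV simp: algebra_simps)
  from has_vector_derivative_real_field[OF this]
  show ?thesis by (simp add: quadratic_exp_def)
qed

text \<open>
  The power \<open>\<bar>x\<bar>\<^sup>i\<close> is at most \<open>i!\<close> times the exponential of \<open>\<bar>x\<bar>\<close>, and the resulting exponent, a
  linear function of \<open>\<bar>x\<bar>\<close> minus half its square, is bounded above.
\<close>

lemma quadratic_exp_poly_bounded:
  "bounded (range (\<lambda>x. poly p (complex_of_real x) * quadratic_exp b x))"
proof -
  define c where "c = 1 + cmod b"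
  have monomial: "\<bar>x\<bar> ^ i * cmod (quadratic_exp b x) \<le> fact i * exp (c\<^sup>2 / 2)" for i x
  proof -
    have "inverse (fact i) * \<bar>x\<bar> ^ i \<le> exp \<bar>x\<bar>"
      using sum_le_suminf[OF summable_exp[of "\<bar>x\<bar>"], of "{i}"]
      by (simp add: exp_def)
    then have "\<bar>x\<bar> ^ i \<le> fact i * exp \<bar>x\<bar>"
      by (simp add: field_simps)
    moreover have "cmod (quadratic_exp b x) \<le> exp (cmod b * \<bar>x\<bar> - x\<^sup>2 / 2)"
    proof -
      have "Re b * x \<le> \<bar>Re b\<bar> * \<bar>x\<bar>"
        by (metis abs_ge_self abs_mult)
      also have "\<dots> \<le> cmod b * \<bar>x\<bar>"
        by (intro mult_right_mono abs_Re_le_cmod) auto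
      finally show ?thesis by (simp add: quadratic_exp_def)
    qed
    ultimately have "\<bar>x\<bar> ^ i * cmod (quadratic_exp b x)
        \<le> (fact i * exp \<bar>x\<bar>) * exp (cmod b * \<bar>x\<bar> - x\<^sup>2 / 2)"
      by (intro mult_mono) auto
    also have "\<dots> = fact i * exp (c * \<bar>x\<bar> - x\<^sup>2 / 2)"
      by (simp add: c_def exp_add[symmetric] algebra_simps)
    also have "c * \<bar>x\<bar> - x\<^sup>2 / 2 \<le> c\<^sup>2 / 2"
      using zero_le_power2[of "c - \<bar>x\<bar>"] by (simp add: power2_eq_square algebra_simps)
    finally show ?thesis by simp
  qed
  have "cmod (poly p (complex_of_real x) * quadratic_exp b x)
      \<le> (\<Sum>i\<le>degree p. cmod (coeff p i) * (fact i * exp (c\<^sup>2 / 2)))" for x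
  proof -
    have "cmod (poly p (complex_of_real x) * quadratic_exp b x)
        \<le> (\<Sum>i\<le>degree p. cmod (coeff p i * of_real x ^ i)) * cmod (quadratic_exp b x)"
      by (subst norm_mult, subst poly_altdef, intro mult_right_mono norm_sum) auto
    also have "\<dots> = (\<Sum>i\<le>degree p. cmod (coeff p i) * (\<bar>x\<bar> ^ i * cmod (quadratic_exp b x)))"
      by (simp add: sum_distrib_right norm_mult norm_power mult.assoc)
    also have "\<dots> \<le> (\<Sum>i\<le>degree p. cmod (coeff p i) * (fact i * exp (c\<^sup>2 / 2)))"
      by (intro sum_mono mult_left_mono monomial) auto
    finally show ?thesis .
  qed
  then show ?thesis unfolding bounded_iff by blast
qed

text \<open>
  The products of a polynomial with one quadratic exponential are bounded, and neither differentiation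
  nor multiplication by \<open>x\<close> leaves this class.
\<close>

lemma schwartz_quadratic_exp: "schwartz (quadratic_exp b)"
proof -
  define S where "S = range (\<lambda>p x. poly p (complex_of_real x) * quadratic_exp b x)"
  have in_S: "quadratic_exp b \<in> S"
    unfolding S_def by (rule range_eqI[of _ _ 1]) auto
  have closed: "\<exists>g'\<in>S. \<forall>x. (g has_vector_derivative g' x) (at x)" if g_in: "g \<in> S" for g
  proof -
    obtain p where g: "g = (\<lambda>x. poly p (complex_of_real x) * quadratic_exp b x)"
      using g_in unfolding S_def by auto
    show ?thesis
      unfolding g S_def using quadratic_exp_deriv[of p b] by (intro bexI[OF _ rangeI] allI)
  qed
  have "bounded (range (\<lambda>x. x ^ k *\<^sub>R nth_deriv n (quadratic_exp b) x))" for k n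
  proof -
    obtain p where p: "nth_deriv n (quadratic_exp b) = (\<lambda>x. poly p (complex_of_real x) * quadratic_exp b x)"
      using closed_under_derivative(1)[OF closed in_S] unfolding S_def by blast
    show ?thesis
      using quadratic_exp_poly_bounded[of "monom 1 k * p" b]
      by (simp add: p poly_monom scaleR_conv_of_real mult.assoc)
  qed
  then show ?thesis
    using closed_under_derivative(2)[OF closed in_S] by (simp add: schwartz_def)
qed

section \<open>The Fourier transform of integrable functions\<close>

lemma integrable_pair_if_bounded_by_product:
  fixes F :: "real \<times> real \<Rightarrow> complex" and f g :: "real \<Rightarrow> complex"
  assumes F: "F \<in> borel_measurable (lborel \<Otimes>\<^sub>M lborel)"
    and f: "integrable lborel f" and g: "integrable lborel g"
    and bound: "\<And>x y. cmod (F (x, y)) \<le> cmod (f x) * cmod (g y)"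
  shows "integrable (lborel \<Otimes>\<^sub>M lborel) F"
proof (rule Bochner_Integration.integrable_bound)
  have [measurable]: "f \<in> borel_measurable borel" "g \<in> borel_measurable borel"
    using f g by (auto dest: borel_measurable_integrable)
  show "integrable (lborel \<Otimes>\<^sub>M lborel) (\<lambda>p. f (fst p) * g (snd p))"
  proof (rule lborel_pair.Fubini_integrable)
    show "integrable lborel (\<lambda>x. \<integral>y. cmod (f (fst (x, y)) * g (snd (x, y))) \<partial>lborel)"
      using f by (simp add: norm_mult)
    show "AE x in lborel. integrable lborel (\<lambda>y. f (fst (x, y)) * g (snd (x, y)))"
      using g by simp
  qed measurable
  show "AE p in lborel \<Otimes>\<^sub>M lborel. cmod (F p) \<le> cmod (f (fst p) * g (snd p))"
    using bound by (auto simp: norm_mult)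
qed (rule F)

lemma integrable_mult_bounded:
  fixes f g :: "real \<Rightarrow> complex"
  assumes f: "integrable lborel f" and g: "g \<in> borel_measurable borel"
    and bound: "\<And>x. cmod (g x) \<le> B"
  shows "integrable lborel (\<lambda>x. f x * g x)"
proof (rule Bochner_Integration.integrable_bound)
  show "integrable lborel (\<lambda>x. B *\<^sub>R f x)" using f by simp
  show "(\<lambda>x. f x * g x) \<in> borel_measurable lborel"
    using f g by (auto dest: borel_measurable_integrable)
  have "B \<ge> 0" using bound[of 0] norm_ge_zero order_trans by blast
  then show "AE x in lborel. cmod (f x * g x) \<le> cmod (B *\<^sub>R f x)"
    using bound by (intro AE_I2) (simp add: norm_mult mult.commute[of B] mult_left_mono)
qed

lemma cnj_measurable [measurable]: "cnj \<in> borel_measurable borel"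
  by (intro borel_measurable_continuous_onI continuous_intros)

lemma cis_measurable [measurable]: "cis \<in> borel_measurable borel"
  by (intro borel_measurable_continuous_onI continuous_intros)

lemma fourier_measurable [measurable (raw)]:
  assumes "f \<in> borel_measurable borel"
  shows "fourier f \<in> borel_measurable borel"
proof -
  note assms[measurable]
  have "(\<lambda>\<xi>. \<integral>x. cis (- (x * \<xi>)) * f x \<partial>lborel) \<in> borel_measurable borel"
    by measurable
  then show ?thesis by (simp add: fourier_def[abs_def])
qed

lemma fourier_bounded: "cmod (fourier f \<xi>) \<le> (\<integral>x. cmod (f x) \<partial>lborel)"
proof -
  have "cmod (fourier f \<xi>) \<le> (\<integral>x. cmod (cis (- (x * \<xi>)) * f x) \<partial>lborel)"
    unfolding fourier_def by (rule integral_norm_bound)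
  then show ?thesis by (simp add: norm_mult)
qed

lemma integrable_cis_mult:
  assumes "integrable lborel f"
  shows "integrable lborel (\<lambda>x. cis (a * x + b) * f x)"
proof -
  have "integrable lborel (\<lambda>x. f x * cis (a * x + b))"
    by (rule integrable_mult_bounded[OF assms, where B = 1]) auto
  then show ?thesis by (simp add: mult.commute)
qed

text \<open>
  The multiplication formula, which is Fubini's theorem. All later computations with the transform are
  applications of it with a Gaussian factor in \<open>g\<close>.
\<close>

lemma fourier_duality:
  assumes f: "integrable lborel f" and g: "integrable lborel g"
  shows "(\<integral>\<xi>. fourier f \<xi> * g \<xi> \<partial>lborel) = (\<integral>x. f x * fourier g x \<partial>lborel)"
proof -
  have [measurable]: "f \<in> borel_measurable borel" "g \<in> borel_measurable borel"
    using f g by (auto dest: borel_measurable_integrable)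
  have int: "integrable (lborel \<Otimes>\<^sub>M lborel) (\<lambda>(x, \<xi>). cis (- (x * \<xi>)) * f x * g \<xi>)"
    by (rule integrable_pair_if_bounded_by_product[OF _ f g]) (auto simp: norm_mult)
  have "(\<integral>\<xi>. fourier f \<xi> * g \<xi> \<partial>lborel)
      = (\<integral>\<xi>. (\<integral>x. cis (- (x * \<xi>)) * f x * g \<xi> \<partial>lborel) \<partial>lborel)"
    by (simp add: fourier_def)
  also have "\<dots> = (\<integral>x. (\<integral>\<xi>. cis (- (x * \<xi>)) * f x * g \<xi> \<partial>lborel) \<partial>lborel)"
    by (rule lborel_pair.Fubini_integral[OF int])
  also have "\<dots> = (\<integral>x. (\<integral>\<xi>. f x * (cis (- (\<xi> * x)) * g \<xi>) \<partial>lborel) \<partial>lborel)"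
    by (simp add: mult_ac)
  also have "\<dots> = (\<integral>x. f x * fourier g x \<partial>lborel)"
    by (simp add: fourier_def)
  finally show ?thesis .
qed

lemma fourier_reflect: "fourier (\<lambda>x. f (- x)) \<xi> = fourier f (- \<xi>)"
  using lborel_integral_real_affine[of "-1" "\<lambda>x. cis (- (x * \<xi>)) * f (- x)" 0]
  by (simp add: fourier_def)

lemma inv_fourier_eq_fourier: "inv_fourier g x = fourier g (- x) / complex_of_real (2 * pi)"
  by (simp add: inv_fourier_def fourier_def mult.commute)

lemma inv_fourier_duality:
  assumes f: "integrable lborel f" and g: "integrable lborel g"
  shows "(\<integral>x. f x * inv_fourier g x \<partial>lborel)
       = (\<integral>\<xi>. fourier f (- \<xi>) * g \<xi> \<partial>lborel) / complex_of_real (2 * pi)"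
proof -
  have "(\<integral>x. f x * fourier g (- x) \<partial>lborel) = (\<integral>x. f (- x) * fourier g x \<partial>lborel)"
    using lborel_integral_real_affine[of "-1" "\<lambda>x. f x * fourier g (- x)" 0] by simp
  also have "\<dots> = (\<integral>\<xi>. fourier (\<lambda>x. f (- x)) \<xi> * g \<xi> \<partial>lborel)"
    using f g lborel_integrable_real_affine[OF f, of "-1" 0] by (subst fourier_duality) auto
  finally show ?thesis
    by (simp add: inv_fourier_eq_fourier fourier_reflect)
qed

section \<open>Gaussian regularisation, inversion and the Bessel inequality\<close>

definition gauss :: "real \<Rightarrow> real" where
  "gauss x = exp (- x\<^sup>2 / 2)"

lemma gauss_measurable [measurable]: "gauss \<in> borel_measurable borel"
  unfolding gauss_def[abs_def] by measurable

lemma gauss_pos: "gauss x > 0"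
  by (simp add: gauss_def)

lemma gauss_le_1: "gauss x \<le> 1"
  by (simp add: gauss_def)

lemma gauss_conv_density: "gauss x = sqrt (2 * pi) * std_normal_density x"
  by (simp add: gauss_def std_normal_density_def)

lemma integrable_gauss: "integrable lborel gauss"
  by (simp add: gauss_conv_density[abs_def])

lemma integral_gauss: "(\<integral>x. gauss x \<partial>lborel) = sqrt (2 * pi)"
  by (simp add: gauss_conv_density)

lemma nn_integral_gauss: "(\<integral>\<^sup>+x. ennreal (gauss x) \<partial>lborel) = ennreal (sqrt (2 * pi))"
  using integrable_gauss gauss_pos
  by (subst nn_integral_eq_integral) (auto simp: integral_gauss less_imp_le)

lemma integrable_gauss_scaled: "\<epsilon> \<noteq> 0 \<Longrightarrow> integrable lborel (\<lambda>x. gauss (\<epsilon> * x))"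
  using lborel_integrable_real_affine[OF integrable_gauss, of \<epsilon> 0] by simp

lemma integral_cis_gauss:
  "(\<integral>\<xi>. cis (t * \<xi>) * complex_of_real (gauss \<xi>) \<partial>lborel) = complex_of_real (sqrt (2 * pi) * gauss t)"
proof -
  have "complex_of_real (gauss t) = char std_normal_distribution t"
    by (simp add: char_std_normal_distribution gauss_def)
  also have "\<dots> = (\<integral>\<xi>. std_normal_density \<xi> *\<^sub>R cis (t * \<xi>) \<partial>lborel)"
    by (simp add: char_def integral_density cis_conv_exp)
  finally have "complex_of_real (sqrt (2 * pi) * gauss t)
      = complex_of_real (sqrt (2 * pi)) * (\<integral>\<xi>. std_normal_density \<xi> *\<^sub>R cis (t * \<xi>) \<partial>lborel)"
    by simp
  also have "\<dots> = (\<integral>\<xi>. complex_of_real (sqrt (2 * pi)) * (std_normal_density \<xi> *\<^sub>R cis (t * \<xi>)) \<partial>lborel)"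
    by (simp only: integral_mult_right_zero)
  also have "\<dots> = (\<integral>\<xi>. cis (t * \<xi>) * complex_of_real (gauss \<xi>) \<partial>lborel)"
    by (intro Bochner_Integration.integral_cong refl)
       (simp add: gauss_conv_density scaleR_conv_of_real mult_ac)
  finally show ?thesis by simp
qed

lemma fourier_translated_gauss:
  "fourier (\<lambda>x. complex_of_real (gauss (x - a))) \<xi>
     = complex_of_real (sqrt (2 * pi)) * (cis (- (a * \<xi>)) * complex_of_real (gauss \<xi>))"
proof -
  have "fourier (\<lambda>x. complex_of_real (gauss (x - a))) \<xi>
      = (\<integral>x. cis (- (a * \<xi>)) * (cis ((- \<xi>) * x) * complex_of_real (gauss x)) \<partial>lborel)"
    using lborel_integral_real_affine[of 1 "\<lambda>x. cis (- (x * \<xi>)) * complex_of_real (gauss (x - a))" a]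
    by (simp add: fourier_def cis_mult algebra_simps flip: mult.assoc)
  also have "\<dots> = cis (- (a * \<xi>)) * (\<integral>x. cis ((- \<xi>) * x) * complex_of_real (gauss x) \<partial>lborel)"
    by simp
  also have "\<dots> = complex_of_real (sqrt (2 * pi)) * (cis (- (a * \<xi>)) * complex_of_real (gauss \<xi>))"
    by (subst integral_cis_gauss) (simp add: gauss_def)
  finally show ?thesis .
qed

text \<open>
  The inversion integral converges once a Gaussian factor is inserted, and duality moves the transform
  to this factor. The result is an average of \<open>w\<close> around \<open>x\<close> at scale \<open>\<epsilon>\<close>.
\<close>

lemma gauss_regularised_inversion:
  assumes w: "integrable lborel w" and \<epsilon>: "\<epsilon> > 0"
  shows "(\<integral>\<xi>. fourier w \<xi> * (cis (x * \<xi>) * complex_of_real (gauss (\<epsilon> * \<xi>))) \<partial>lborel)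
       = complex_of_real (sqrt (2 * pi)) * (\<integral>z. w (x + \<epsilon> * z) * complex_of_real (gauss z) \<partial>lborel)"
proof -
  have transform: "fourier (\<lambda>\<xi>. cis (x * \<xi>) * complex_of_real (gauss (\<epsilon> * \<xi>))) y
      = complex_of_real (sqrt (2 * pi) / \<epsilon> * gauss ((x - y) / \<epsilon>))" for y
  proof -
    have "fourier (\<lambda>\<xi>. cis (x * \<xi>) * complex_of_real (gauss (\<epsilon> * \<xi>))) y
        = (\<integral>\<xi>. cis ((x - y) * \<xi>) * complex_of_real (gauss (\<epsilon> * \<xi>)) \<partial>lborel)"
      by (simp add: fourier_def cis_mult algebra_simps flip: mult.assoc)
    also have "\<dots> = (1 / \<epsilon>) *\<^sub>R (\<integral>\<xi>. cis ((x - y) / \<epsilon> * \<xi>) * complex_of_real (gauss \<xi>) \<partial>lborel)"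
      using \<epsilon> by (subst lborel_integral_real_affine[of "1 / \<epsilon>" _ 0]) simp_all
    also have "\<dots> = complex_of_real (sqrt (2 * pi) / \<epsilon> * gauss ((x - y) / \<epsilon>))"
      unfolding integral_cis_gauss by (simp add: scaleR_conv_of_real)
    finally show ?thesis .
  qed
  have int: "integrable lborel (\<lambda>\<xi>. cis (x * \<xi>) * complex_of_real (gauss (\<epsilon> * \<xi>)))"
    using integrable_cis_mult[of "\<lambda>\<xi>. complex_of_real (gauss (\<epsilon> * \<xi>))" x 0]
      integrable_gauss_scaled[of \<epsilon>] \<epsilon> by simp
  have "(\<integral>\<xi>. fourier w \<xi> * (cis (x * \<xi>) * complex_of_real (gauss (\<epsilon> * \<xi>))) \<partial>lborel)
      = (\<integral>y. w y * complex_of_real (sqrt (2 * pi) / \<epsilon> * gauss ((x - y) / \<epsilon>)) \<partial>lborel)"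
    by (simp only: fourier_duality[OF w int] transform)
  also have "\<dots> = \<epsilon> *\<^sub>R (\<integral>z. w (x + \<epsilon> * z) * complex_of_real (sqrt (2 * pi) / \<epsilon> * gauss (- z)) \<partial>lborel)"
    using \<epsilon> by (subst lborel_integral_real_affine[of \<epsilon> _ x]) auto
  also have "\<dots> = (\<integral>z. complex_of_real (sqrt (2 * pi)) * (w (x + \<epsilon> * z) * complex_of_real (gauss z)) \<partial>lborel)"
    unfolding integral_scaleR_right[symmetric] using \<epsilon>
    by (intro Bochner_Integration.integral_cong refl)
       (simp add: gauss_def scaleR_conv_of_real field_simps)
  also have "\<dots> = complex_of_real (sqrt (2 * pi)) * (\<integral>z. w (x + \<epsilon> * z) * complex_of_real (gauss z) \<partial>lborel)"
    by simp
  finally show ?thesis .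
qed

lemma gauss_vanishing_dilation: "(\<lambda>n. gauss (inverse (real (Suc n)) * \<xi>)) \<longlonglongrightarrow> 1"
proof -
  have "(\<lambda>n. inverse (real (Suc n)) * \<xi>) \<longlonglongrightarrow> 0 * \<xi>"
    by (intro tendsto_intros LIMSEQ_inverse_real_of_nat)
  then have "(\<lambda>n. exp (- (inverse (real (Suc n)) * \<xi>)\<^sup>2 / 2)) \<longlonglongrightarrow> exp (- 0\<^sup>2 / 2)"
    by (intro tendsto_intros) auto
  then show ?thesis by (simp add: gauss_def)
qed

text \<open>
  Both sides of the regularised formula converge by dominated convergence as \<open>\<epsilon>\<close> tends to \<open>0\<close>: the
  left because the transform is integrable, the right because \<open>w\<close> is bounded and continuous.
\<close>

theorem fourier_inversion:
  assumes w: "integrable lborel w" and cont: "continuous_on UNIV w"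
    and bounded: "\<And>x. cmod (w x) \<le> B" and fw: "integrable lborel (fourier w)"
  shows "inv_fourier (fourier w) x = w x"
proof -
  define \<epsilon> where "\<epsilon> n = inverse (real (Suc n))" for n
  have [measurable]: "w \<in> borel_measurable borel"
    using w by (auto dest: borel_measurable_integrable)
  have "(\<lambda>n. \<integral>\<xi>. fourier w \<xi> * (cis (x * \<xi>) * complex_of_real (gauss (\<epsilon> n * \<xi>))) \<partial>lborel)
      \<longlonglongrightarrow> (\<integral>\<xi>. fourier w \<xi> * (cis (x * \<xi>) * complex_of_real 1) \<partial>lborel)"
  proof (rule integral_dominated_convergence)
    show "integrable lborel (\<lambda>\<xi>. cmod (fourier w \<xi>))" using fw by simp
    show "AE \<xi> in lborel. (\<lambda>n. fourier w \<xi> * (cis (x * \<xi>) * complex_of_real (gauss (\<epsilon> n * \<xi>))))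
        \<longlonglongrightarrow> fourier w \<xi> * (cis (x * \<xi>) * complex_of_real 1)"
      unfolding \<epsilon>_def by (intro AE_I2 tendsto_intros gauss_vanishing_dilation)
    show "AE \<xi> in lborel. cmod (fourier w \<xi> * (cis (x * \<xi>) * complex_of_real (gauss (\<epsilon> n * \<xi>))))
        \<le> cmod (fourier w \<xi>)" for n
      using gauss_pos gauss_le_1 by (intro AE_I2) (simp add: norm_mult mult_left_le less_imp_le)
  qed measurable
  then have lim1: "(\<lambda>n. complex_of_real (sqrt (2 * pi)) * (\<integral>z. w (x + \<epsilon> n * z) * complex_of_real (gauss z) \<partial>lborel))
      \<longlonglongrightarrow> (\<integral>\<xi>. fourier w \<xi> * (cis (x * \<xi>) * complex_of_real 1) \<partial>lborel)"
    by (subst (asm) gauss_regularised_inversion[OF w]) (auto simp: \<epsilon>_def)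
  have "(\<lambda>n. \<integral>z. w (x + \<epsilon> n * z) * complex_of_real (gauss z) \<partial>lborel)
      \<longlonglongrightarrow> (\<integral>z. w x * complex_of_real (gauss z) \<partial>lborel)"
  proof (rule integral_dominated_convergence)
    show "integrable lborel (\<lambda>z. B * gauss z)" using integrable_gauss by simp
    have "(\<lambda>n. x + \<epsilon> n * z) \<longlonglongrightarrow> x + 0 * z" for z
      unfolding \<epsilon>_def by (intro tendsto_intros LIMSEQ_inverse_real_of_nat)
    then have "(\<lambda>n. w (x + \<epsilon> n * z)) \<longlonglongrightarrow> w x" for z
      using continuous_on_tendsto_compose[OF cont, of "\<lambda>n. x + \<epsilon> n * z" x sequentially] by simp
    then show "AE z in lborel. (\<lambda>n. w (x + \<epsilon> n * z) * complex_of_real (gauss z))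
        \<longlonglongrightarrow> w x * complex_of_real (gauss z)"
      by (intro AE_I2 tendsto_intros)
    show "AE z in lborel. cmod (w (x + \<epsilon> n * z) * complex_of_real (gauss z)) \<le> B * gauss z" for n
      using bounded gauss_pos by (intro AE_I2) (simp add: norm_mult less_imp_le mult_right_mono)
  qed measurable
  also have "(\<integral>z. w x * complex_of_real (gauss z) \<partial>lborel) = w x * complex_of_real (sqrt (2 * pi))"
    by (simp only: integral_mult_right_zero integral_complex_of_real integral_gauss)
  finally have "(\<integral>\<xi>. fourier w \<xi> * (cis (x * \<xi>) * complex_of_real 1) \<partial>lborel)
      = complex_of_real (sqrt (2 * pi)) * (w x * complex_of_real (sqrt (2 * pi)))"
    by (intro LIMSEQ_unique[OF lim1] tendsto_mult tendsto_const)
  also have "\<dots> = complex_of_real (sqrt (2 * pi) * sqrt (2 * pi)) * w x"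
    by (simp only: of_real_mult mult_ac)
  also have "\<dots> = complex_of_real (2 * pi) * w x"
    by simp
  finally show ?thesis
    by (simp add: inv_fourier_def mult.commute)
qed

text \<open>
  The upper bound in Plancherel's theorem. With the factor \<open>gauss (\<epsilon> * \<xi>)\<close> the left side becomes, by
  duality, an average over \<open>z\<close> of the correlation of \<open>w\<close> with its translate by \<open>\<epsilon> * z\<close>. Each
  correlation is at most the squared \<open>L\<^sup>2\<close> norm, by \<open>a b \<le> (a\<^sup>2 + b\<^sup>2) / 2\<close> and translation
  invariance. Fatou's lemma removes the factor.
\<close>

theorem bessel_inequality:
  assumes w: "integrable lborel w" and w2: "integrable lborel (\<lambda>x. (cmod (w x))\<^sup>2)"
  shows "integrable lborel (\<lambda>\<xi>. (cmod (fourier w \<xi>))\<^sup>2)"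
    and "(\<integral>\<xi>. (cmod (fourier w \<xi>))\<^sup>2 \<partial>lborel) \<le> 2 * pi * (\<integral>x. (cmod (w x))\<^sup>2 \<partial>lborel)"
proof -
  have [measurable]: "w \<in> borel_measurable borel"
    using w by (auto dest: borel_measurable_integrable)
  define N where "N = (\<integral>x. (cmod (w x))\<^sup>2 \<partial>lborel)"
  have "N \<ge> 0" unfolding N_def by simp
  have N: "(\<integral>\<^sup>+x. ennreal ((cmod (w x))\<^sup>2) \<partial>lborel) = ennreal N"
    unfolding N_def using w2 by (intro nn_integral_eq_integral) auto
  have N_shift: "(\<integral>\<^sup>+x. ennreal ((cmod (w (x + t)))\<^sup>2) \<partial>lborel) = ennreal N" for t
    unfolding N[symmetric] by (subst (2) nn_integral_real_affine[of _ 1 t]) (auto simp: add.commute)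
  have regularised: "(\<integral>\<^sup>+\<xi>. ennreal ((cmod (fourier w \<xi>))\<^sup>2 * gauss (\<epsilon> * \<xi>)) \<partial>lborel) \<le> ennreal (2 * pi * N)"
    if \<epsilon>: "\<epsilon> > 0" for \<epsilon>
  proof -
    \<comment> \<open>With this \<open>g\<close>, duality turns the regularised square norm into a pairing of \<open>w\<close> with an
      average of its translates.\<close>
    define g where "g \<xi> = cnj (fourier w \<xi>) * complex_of_real (gauss (\<epsilon> * \<xi>))" for \<xi>
    have g: "integrable lborel g"
    proof -
      have "integrable lborel (\<lambda>\<xi>. complex_of_real (gauss (\<epsilon> * \<xi>)) * cnj (fourier w \<xi>))"
        using integrable_gauss_scaled[of \<epsilon>] \<epsilon>
        by (intro integrable_mult_bounded[where B = "\<integral>x. cmod (w x) \<partial>lborel"])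
           (auto simp: fourier_bounded)
      then show ?thesis by (simp add: g_def[abs_def] mult.commute)
    qed
    have fg: "fourier g x = cnj (complex_of_real (sqrt (2 * pi))
        * (\<integral>z. w (x + \<epsilon> * z) * complex_of_real (gauss z) \<partial>lborel))" for x
      unfolding gauss_regularised_inversion[OF w \<epsilon>, symmetric]
      by (simp add: fourier_def[of g] g_def cis_cnj mult_ac flip: Bochner_Integration.integral_cnj)
    have int_sq: "integrable lborel (\<lambda>\<xi>. (cmod (fourier w \<xi>))\<^sup>2 * gauss (\<epsilon> * \<xi>))"
    proof -
      have "integrable lborel (\<lambda>\<xi>. g \<xi> * fourier w \<xi>)"
        by (rule integrable_mult_bounded[OF g _ fourier_bounded]) simp
      moreover have "(\<lambda>\<xi>. cmod (g \<xi> * fourier w \<xi>)) = (\<lambda>\<xi>. (cmod (fourier w \<xi>))\<^sup>2 * gauss (\<epsilon> * \<xi>))"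
        using gauss_pos by (auto simp: g_def norm_mult power2_eq_square less_imp_le)
      ultimately show ?thesis using integrable_norm by fastforce
    qed
    have "complex_of_real (\<integral>\<xi>. (cmod (fourier w \<xi>))\<^sup>2 * gauss (\<epsilon> * \<xi>) \<partial>lborel)
        = (\<integral>\<xi>. fourier w \<xi> * g \<xi> \<partial>lborel)"
      unfolding integral_complex_of_real[symmetric] g_def
      by (intro Bochner_Integration.integral_cong refl) (simp only: of_real_mult complex_norm_square mult.assoc)
    also have "\<dots> = (\<integral>x. w x * fourier g x \<partial>lborel)"
      by (rule fourier_duality[OF w g])
    finally have "cmod (complex_of_real (\<integral>\<xi>. (cmod (fourier w \<xi>))\<^sup>2 * gauss (\<epsilon> * \<xi>) \<partial>lborel))
        = cmod (\<integral>x. w x * fourier g x \<partial>lborel)"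
      by (rule arg_cong)
    moreover have "(\<integral>\<xi>. (cmod (fourier w \<xi>))\<^sup>2 * gauss (\<epsilon> * \<xi>) \<partial>lborel) \<ge> 0"
      using gauss_pos by (intro integral_nonneg_AE AE_I2) (simp add: less_imp_le)
    ultimately have eq: "(\<integral>\<xi>. (cmod (fourier w \<xi>))\<^sup>2 * gauss (\<epsilon> * \<xi>) \<partial>lborel)
        = cmod (\<integral>x. w x * fourier g x \<partial>lborel)"
      by (simp only: norm_of_real abs_of_nonneg)
    have inner: "(\<integral>\<^sup>+x. ennreal (((cmod (w x))\<^sup>2 + (cmod (w (x + \<epsilon> * z)))\<^sup>2) / 2 * gauss z) \<partial>lborel)
        = ennreal N * ennreal (gauss z)" for z
    proof -
      have "ennreal (((cmod (w x))\<^sup>2 + (cmod (w (x + \<epsilon> * z)))\<^sup>2) / 2 * gauss z)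
          = ennreal (gauss z / 2) * (ennreal ((cmod (w x))\<^sup>2) + ennreal ((cmod (w (x + \<epsilon> * z)))\<^sup>2))" for x
        using gauss_pos[of z]
        by (simp add: field_simps flip: ennreal_plus ennreal_mult)
      then have "(\<integral>\<^sup>+x. ennreal (((cmod (w x))\<^sup>2 + (cmod (w (x + \<epsilon> * z)))\<^sup>2) / 2 * gauss z) \<partial>lborel)
          = ennreal (gauss z / 2) * (ennreal N + ennreal N)"
        by (simp add: nn_integral_cmult nn_integral_add N N_shift)
      also have "\<dots> = ennreal N * ennreal (gauss z)"
        using \<open>N \<ge> 0\<close> gauss_pos[of z] by (simp flip: ennreal_plus ennreal_mult)
      finally show ?thesis .
    qed
    have "(\<integral>\<^sup>+\<xi>. ennreal ((cmod (fourier w \<xi>))\<^sup>2 * gauss (\<epsilon> * \<xi>)) \<partial>lborel)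
        = ennreal (cmod (\<integral>x. w x * fourier g x \<partial>lborel))"
      using int_sq gauss_pos eq by (subst nn_integral_eq_integral) (auto simp: less_imp_le)
    also have "\<dots> \<le> (\<integral>\<^sup>+x. ennreal (cmod (w x * fourier g x)) \<partial>lborel)"
      using g by (intro integral_norm_bound_ennreal integrable_mult_bounded[OF w _ fourier_bounded])
        (auto dest: borel_measurable_integrable)
    also have "\<dots> \<le> (\<integral>\<^sup>+x. ennreal (sqrt (2 * pi)) * (\<integral>\<^sup>+z. ennreal (((cmod (w x))\<^sup>2 + (cmod (w (x + \<epsilon> * z)))\<^sup>2) / 2 * gauss z) \<partial>lborel) \<partial>lborel)"
    proof (rule nn_integral_mono)
      fix x :: real
      have "ennreal (cmod (w x) * cmod (\<integral>z. w (x + \<epsilon> * z) * complex_of_real (gauss z) \<partial>lborel))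
          = ennreal (cmod (\<integral>z. w x * (w (x + \<epsilon> * z) * complex_of_real (gauss z)) \<partial>lborel))"
        by (simp add: norm_mult)
      also have "\<dots> \<le> (\<integral>\<^sup>+z. ennreal (cmod (w x * (w (x + \<epsilon> * z) * complex_of_real (gauss z)))) \<partial>lborel)"
      proof (intro integral_norm_bound_ennreal integrable_mult_right)
        show "integrable lborel (\<lambda>z. w (x + \<epsilon> * z) * complex_of_real (gauss z))"
          using lborel_integrable_real_affine[OF w, of \<epsilon> x] \<epsilon> gauss_pos gauss_le_1
          by (intro integrable_mult_bounded[where B = 1]) (auto simp: less_imp_le)
      qed
      also have "\<dots> \<le> (\<integral>\<^sup>+z. ennreal (((cmod (w x))\<^sup>2 + (cmod (w (x + \<epsilon> * z)))\<^sup>2) / 2 * gauss z) \<partial>lborel)"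
      proof (intro nn_integral_mono ennreal_leI)
        fix z
        have "cmod (w x) * cmod (w (x + \<epsilon> * z)) \<le> ((cmod (w x))\<^sup>2 + (cmod (w (x + \<epsilon> * z)))\<^sup>2) / 2"
          using sum_squares_bound[of "cmod (w x)" "cmod (w (x + \<epsilon> * z))"] by simp
        from mult_right_mono[OF this, of "gauss z"] gauss_pos[of z]
        show "cmod (w x * (w (x + \<epsilon> * z) * complex_of_real (gauss z)))
            \<le> ((cmod (w x))\<^sup>2 + (cmod (w (x + \<epsilon> * z)))\<^sup>2) / 2 * gauss z"
          by (simp add: norm_mult mult.assoc)
      qed
      finally have "ennreal (sqrt (2 * pi)) * ennreal (cmod (w x) * cmod (\<integral>z. w (x + \<epsilon> * z) * complex_of_real (gauss z) \<partial>lborel))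
          \<le> ennreal (sqrt (2 * pi)) * (\<integral>\<^sup>+z. ennreal (((cmod (w x))\<^sup>2 + (cmod (w (x + \<epsilon> * z)))\<^sup>2) / 2 * gauss z) \<partial>lborel)"
        by (intro mult_left_mono) auto
      then show "ennreal (cmod (w x * fourier g x))
          \<le> ennreal (sqrt (2 * pi)) * (\<integral>\<^sup>+z. ennreal (((cmod (w x))\<^sup>2 + (cmod (w (x + \<epsilon> * z)))\<^sup>2) / 2 * gauss z) \<partial>lborel)"
        by (simp add: fg norm_mult mult_ac flip: ennreal_mult)
    qed
    also have "\<dots> = ennreal (sqrt (2 * pi)) * (\<integral>\<^sup>+z. (\<integral>\<^sup>+x. ennreal (((cmod (w x))\<^sup>2 + (cmod (w (x + \<epsilon> * z)))\<^sup>2) / 2 * gauss z) \<partial>lborel) \<partial>lborel)"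
      by (subst nn_integral_cmult, measurable) (subst lborel_pair.Fubini', auto)
    also have "\<dots> = ennreal (sqrt (2 * pi)) * (\<integral>\<^sup>+z. ennreal N * ennreal (gauss z) \<partial>lborel)"
      by (simp only: inner)
    also have "\<dots> = ennreal (sqrt (2 * pi)) * (ennreal N * ennreal (sqrt (2 * pi)))"
      by (subst nn_integral_cmult, measurable, subst nn_integral_gauss, rule refl)
    also have "\<dots> = ennreal (sqrt (2 * pi) * (N * sqrt (2 * pi)))"
    proof -
      have *: "ennreal a * (ennreal N * ennreal a) = ennreal (a * (N * a))" if "a \<ge> 0" for a
        using that \<open>N \<ge> 0\<close> by (simp only: ennreal_mult mult_nonneg_nonneg)
      show ?thesis by (rule *) simp
    qed
    also have "\<dots> = ennreal (2 * pi * N)"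
    proof -
      have "sqrt (2 * pi) * (N * sqrt (2 * pi)) = (sqrt (2 * pi))\<^sup>2 * N"
        by (simp only: power2_eq_square mult_ac)
      moreover have "(sqrt (2 * pi))\<^sup>2 = 2 * pi"
        by (rule real_sqrt_pow2) simp
      ultimately show ?thesis by (simp only:)
    qed
    finally show ?thesis .
  qed
  define F where "F n \<xi> = ennreal ((cmod (fourier w \<xi>))\<^sup>2 * gauss (inverse (real (Suc n)) * \<xi>))" for n \<xi>
  have "(\<lambda>n. F n \<xi>) \<longlonglongrightarrow> ennreal ((cmod (fourier w \<xi>))\<^sup>2 * 1)" for \<xi>
    unfolding F_def by (intro tendsto_intros gauss_vanishing_dilation)
  then have "liminf (\<lambda>n. F n \<xi>) = ennreal ((cmod (fourier w \<xi>))\<^sup>2)" for \<xi>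
    using lim_imp_Liminf[of sequentially "\<lambda>n. F n \<xi>"] by simp
  then have "(\<integral>\<^sup>+\<xi>. ennreal ((cmod (fourier w \<xi>))\<^sup>2) \<partial>lborel) = (\<integral>\<^sup>+\<xi>. liminf (\<lambda>n. F n \<xi>) \<partial>lborel)"
    by simp
  also have "\<dots> \<le> liminf (\<lambda>n. \<integral>\<^sup>+\<xi>. F n \<xi> \<partial>lborel)"
    by (rule nn_integral_liminf) (auto simp: F_def)
  also have "\<dots> \<le> ennreal (2 * pi * N)"
  proof (rule Liminf_le)
    show "\<forall>\<^sub>F n in sequentially. (\<integral>\<^sup>+\<xi>. F n \<xi> \<partial>lborel) \<le> ennreal (2 * pi * N)"
      unfolding F_def by (intro always_eventually allI regularised) simp
  qed simp
  finally have bound: "(\<integral>\<^sup>+\<xi>. ennreal ((cmod (fourier w \<xi>))\<^sup>2) \<partial>lborel) \<le> ennreal (2 * pi * N)" .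
  show int: "integrable lborel (\<lambda>\<xi>. (cmod (fourier w \<xi>))\<^sup>2)"
  proof (rule integrableI_bounded)
    show "(\<integral>\<^sup>+\<xi>. ennreal (norm ((cmod (fourier w \<xi>))\<^sup>2)) \<partial>lborel) < \<infinity>"
      using order.strict_trans1[OF bound ennreal_less_top] by simp
  qed simp
  show "(\<integral>\<xi>. (cmod (fourier w \<xi>))\<^sup>2 \<partial>lborel) \<le> 2 * pi * (\<integral>x. (cmod (w x))\<^sup>2 \<partial>lborel)"
  proof -
    have "ennreal (\<integral>\<xi>. (cmod (fourier w \<xi>))\<^sup>2 \<partial>lborel) \<le> ennreal (2 * pi * N)"
      using bound by (subst nn_integral_eq_integral[OF int, symmetric]) auto
    then show ?thesis
      using \<open>N \<ge> 0\<close> unfolding N_def[symmetric] by (subst (asm) ennreal_le_iff) auto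
  qed
qed

section \<open>Injectivity and the Fourier transform on \<open>L\<^sup>2\<close>\<close>

text \<open>
  The positive and the negative part of \<open>w\<close> have the same integral \<open>m\<close>, because the transform of \<open>w\<close>
  vanishes at \<open>0\<close>. Divided by \<open>m\<close> they are densities of probability measures with equal characteristic functions,
  so Levy's uniqueness theorem applies. The case \<open>m = 0\<close> is separate.
\<close>

lemma fourier_injective_real:
  fixes w :: "real \<Rightarrow> real"
  assumes w: "integrable lborel w"
    and zero: "\<And>\<xi>. fourier (\<lambda>x. complex_of_real (w x)) \<xi> = 0"
  shows "AE x in lborel. w x = 0"
proof -
  have [measurable]: "w \<in> borel_measurable borel"
    using w by (auto dest: borel_measurable_integrable)
  define p q where "p x = max (w x) 0" and "q x = max (- w x) 0" for x
  have [measurable]: "p \<in> borel_measurable borel" "q \<in> borel_measurable borel"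
    unfolding p_def[abs_def] q_def[abs_def] by measurable
  have pq: "integrable lborel p" "integrable lborel q"
    using w unfolding p_def[abs_def] q_def[abs_def] by (auto intro!: Bochner_Integration.integrable_max)
  have w_eq: "w x = p x - q x" and pq_nonneg: "p x \<ge> 0" "q x \<ge> 0" for x
    by (auto simp: p_def q_def)
  define m where "m = (\<integral>x. p x \<partial>lborel)"
  have "complex_of_real (\<integral>x. w x \<partial>lborel) = 0"
    using zero[of 0] by (simp add: fourier_def)
  then have m': "m = (\<integral>x. q x \<partial>lborel)"
    using pq by (simp add: w_eq[abs_def] m_def)
  have "m \<ge> 0"
    unfolding m_def using pq_nonneg by (intro integral_nonneg_AE) auto
  then consider "m = 0" | "m > 0" by linarith
  then show ?thesis
  proof cases
    case 1
    then have "AE x in lborel. p x = 0" "AE x in lborel. q x = 0"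
      using integral_nonneg_eq_0_iff_AE[OF pq(1)] integral_nonneg_eq_0_iff_AE[OF pq(2)]
        pq_nonneg m' m_def by auto
    then show ?thesis by eventually_elim (simp add: w_eq)
  next
    case 2
    define D where "D f = density lborel (\<lambda>x. ennreal (f x / m))" for f :: "real \<Rightarrow> real"
    have nn: "(\<integral>\<^sup>+x. ennreal (f x / m) \<partial>lborel) = 1"
      if "integrable lborel f" "\<And>x. f x \<ge> 0" "(\<integral>x. f x \<partial>lborel) = m" for f
      using that 2 by (subst nn_integral_eq_integral) auto
    have distr: "real_distribution (D f)"
      if "integrable lborel f" "\<And>x. f x \<ge> 0" "(\<integral>x. f x \<partial>lborel) = m" for f
    proof -
      have "f \<in> borel_measurable borel"
        using that(1) by (auto dest: borel_measurable_integrable)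
      then have "prob_space (D f)"
        using nn[OF that] by (intro prob_spaceI) (simp add: D_def emeasure_density)
      then show ?thesis
        by (simp add: real_distribution_def real_distribution_axioms_def D_def)
    qed
    \<comment> \<open>The sign in the exponent of \<open>char\<close> is opposite to that of \<open>fourier\<close>.\<close>
    have char_D: "char (D f) t = fourier (\<lambda>x. complex_of_real (f x)) (- t) / complex_of_real m"
      if "integrable lborel f" "\<And>x. f x \<ge> 0" for f t
    proof -
      have [measurable]: "f \<in> borel_measurable borel"
        using that(1) by (auto dest: borel_measurable_integrable)
      have "char (D f) t = (\<integral>x. (f x / m) *\<^sub>R cis (t * x) \<partial>lborel)"
        using that 2 by (simp add: char_def D_def integral_density cis_conv_exp)
      also have "\<dots> = (\<integral>x. cis (- (x * - t)) * complex_of_real (f x) / complex_of_real m \<partial>lborel)"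
        by (intro Bochner_Integration.integral_cong refl) (simp add: scaleR_conv_of_real mult_ac)
      finally show ?thesis by (simp add: fourier_def)
    qed
    have "fourier (\<lambda>x. complex_of_real (p x)) t = fourier (\<lambda>x. complex_of_real (q x)) t" for t
    proof -
      have ints: "integrable lborel (\<lambda>x. cis (- (x * t)) * complex_of_real (f x))"
        if "integrable lborel f" for f :: "real \<Rightarrow> real"
        using integrable_cis_mult[of "\<lambda>x. complex_of_real (f x)" "- t" 0] that
        by (simp add: mult.commute)
      have "0 = fourier (\<lambda>x. complex_of_real (w x)) t" by (simp add: zero)
      also have "\<dots> = fourier (\<lambda>x. complex_of_real (p x)) t - fourier (\<lambda>x. complex_of_real (q x)) t"
        using ints pq by (simp add: fourier_def w_eq[abs_def] right_diff_distrib)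
      finally show ?thesis by simp
    qed
    then have "char (D p) = char (D q)"
      using pq pq_nonneg by (simp add: fun_eq_iff char_D)
    then have eq: "D p = D q"
      using pq pq_nonneg m_def m' by (intro Levy_uniqueness distr) auto
    have "AE x in lborel. ennreal (p x / m) = ennreal (q x / m)"
      using eq nn[OF pq(1) pq_nonneg(1)] m_def unfolding D_def
      by (subst (asm) finite_density_unique) auto
    then show ?thesis
    proof eventually_elim
      case (elim x)
      then show ?case using 2 pq_nonneg[of x] by (simp add: w_eq)
    qed
  qed
qed

lemma fourier_cnj: "fourier (\<lambda>x. cnj (f x)) \<xi> = cnj (fourier f (- \<xi>))"
  by (simp add: fourier_def cis_cnj flip: Bochner_Integration.integral_cnj)

lemma fourier_cmult: "fourier (\<lambda>x. c * f x) \<xi> = c * fourier f \<xi>"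
  by (simp add: fourier_def mult.left_commute)

lemma fourier_add:
  assumes "integrable lborel f" "integrable lborel g"
  shows "fourier (\<lambda>x. f x + g x) \<xi> = fourier f \<xi> + fourier g \<xi>"
  using integrable_cis_mult[OF assms(1), of "- \<xi>" 0] integrable_cis_mult[OF assms(2), of "- \<xi>" 0]
  by (simp add: fourier_def distrib_left mult.commute)

lemma fourier_diff:
  assumes "integrable lborel f" "integrable lborel g"
  shows "fourier (\<lambda>x. f x - g x) \<xi> = fourier f \<xi> - fourier g \<xi>"
  using fourier_add[OF assms(1), of "\<lambda>x. - 1 * g x"] fourier_cmult[of "-1" g] assms(2) by simp

text \<open>
  Conjugating \<open>w\<close> conjugates and reflects the transform, so the real part of \<open>w\<close> has transform zero if
  \<open>w\<close> has. The imaginary part of \<open>w\<close> is the real part of \<open>- \<i> * w\<close>.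
\<close>

theorem fourier_injective:
  assumes w: "integrable lborel w" and zero: "\<And>\<xi>. fourier w \<xi> = 0"
  shows "AE x in lborel. w x = 0"
proof -
  have Re_zero: "AE x in lborel. Re (g x) = 0"
    if g: "integrable lborel g" and g0: "\<And>\<xi>. fourier g \<xi> = 0" for g
  proof (rule fourier_injective_real)
    have "(\<lambda>x. complex_of_real (Re (g x))) = (\<lambda>x. 1 / 2 * (g x + cnj (g x)))"
      by (simp add: complex_add_cnj)
    then show "fourier (\<lambda>x. complex_of_real (Re (g x))) \<xi> = 0" for \<xi>
      using g g0 by (simp only: fourier_cmult) (simp add: fourier_add fourier_cnj)
  qed (use g in simp)
  have "AE x in lborel. Re (w x) = 0"
    by (rule Re_zero[OF w zero])
  moreover have "AE x in lborel. Re (- \<i> * w x) = 0"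
    using w zero by (intro Re_zero) (simp_all only: fourier_cmult integrable_mult_right mult_zero_right)
  ultimately show ?thesis
    by eventually_elim (simp add: complex_eq_iff)
qed

lemma integrable_inverse_1_plus_sq: "integrable lborel (\<lambda>x::real. 1 / (1 + x\<^sup>2))"
  using integrable_inverse_1_plus_square by (simp add: set_integrable_def inverse_eq_divide)

text \<open>
  Boundedness of \<open>(1 + x\<^sup>2)\<^sup>2 * g x\<close> leaves the integrable bound \<open>1 / (1 + x\<^sup>2)\<close> after one factor
  \<open>1 + x\<^sup>2\<close> has absorbed the weight \<open>\<bar>x\<bar>\<^sup>1\<^sup>/\<^sup>2\<close>, the Fourier multiplier of \<open>(-\<Delta>)\<^sup>1\<^sup>/\<^sup>4\<close>.
\<close>

lemma rapid_decay_integrable: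
  fixes g :: "real \<Rightarrow> complex"
  assumes meas: "g \<in> borel_measurable borel"
    and decay: "\<And>k. bounded (range (\<lambda>x. x ^ k *\<^sub>R g x))"
  shows "integrable lborel g" and "integrable lborel (\<lambda>x. complex_of_real (\<bar>x\<bar> powr (1/2)) * g x)"
proof -
  note meas [measurable]
  have bnd: "\<exists>B. \<forall>x. \<bar>x\<bar> ^ k * cmod (g x) \<le> B" for k
    using decay[of k] unfolding bounded_iff by (simp add: power_abs)
  obtain B0 where B0: "cmod (g x) \<le> B0" for x using bnd[of 0] by auto
  obtain B2 where B2: "x\<^sup>2 * cmod (g x) \<le> B2" for x using bnd[of 2] by auto
  obtain B4 where B4: "x ^ 4 * cmod (g x) \<le> B4" for x using bnd[of 4] by auto
  define B where "B = B0 + 2 * B2 + B4"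
  have bound: "(1 + x\<^sup>2) * cmod (g x) \<le> B * (1 / (1 + x\<^sup>2))" for x
  proof -
    have "(1 + x\<^sup>2) * cmod (g x) * (1 + x\<^sup>2) = cmod (g x) + 2 * (x\<^sup>2 * cmod (g x)) + x ^ 4 * cmod (g x)"
      by (simp add: algebra_simps power2_eq_square power4_eq_xxxx)
    also have "\<dots> \<le> B"
      unfolding B_def using B0[of x] B2[of x] B4[of x] by linarith
    finally show ?thesis
      by (simp add: pos_le_divide_eq add_pos_nonneg)
  qed
  have int: "integrable lborel f" if f: "f \<in> borel_measurable borel"
    and le: "\<And>x. cmod (f x) \<le> (1 + x\<^sup>2) * cmod (g x)" for f :: "real \<Rightarrow> complex"
    using integrable_mult_right[OF integrable_inverse_1_plus_sq, of B] f order_trans[OF le bound]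
    by (intro Bochner_Integration.integrable_bound[of _ "\<lambda>x. B * (1 / (1 + x\<^sup>2))" f]
          AE_I2 order_trans[OF _ abs_ge_self[of "B * (1 / (1 + _\<^sup>2))", folded real_norm_def]])
       simp_all
  show "integrable lborel g"
    by (rule int) (simp_all add: mult_le_cancel_right1)
  have sqrt_le: "sqrt \<bar>x\<bar> \<le> 1 + x\<^sup>2" for x :: real
  proof (rule real_le_lsqrt)
    have "\<bar>x\<bar> \<le> 1 + x\<^sup>2"
      using zero_le_power2[of "\<bar>x\<bar> - 1"] abs_ge_zero[of x] by (simp add: power2_diff)
    also have "\<dots> * 1 \<le> (1 + x\<^sup>2) * (1 + x\<^sup>2)"
      by (intro mult_left_mono) auto
    finally show "\<bar>x\<bar> \<le> (1 + x\<^sup>2)\<^sup>2" by (simp add: power2_eq_square)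
  qed auto
  show "integrable lborel (\<lambda>x. complex_of_real (\<bar>x\<bar> powr (1/2)) * g x)"
    using sqrt_le by (intro int) (auto simp: norm_mult powr_half_sqrt intro: mult_right_mono)
qed

lemma schwartz_measurable: "schwartz \<phi> \<Longrightarrow> \<phi> \<in> borel_measurable borel"
  using smooth_continuous[of \<phi> UNIV 0] unfolding schwartz_def
  by (intro borel_measurable_continuous_onI) simp

lemma schwartz_rapid_decay: "schwartz \<phi> \<Longrightarrow> bounded (range (\<lambda>x. x ^ k *\<^sub>R \<phi> x))"
  unfolding schwartz_def by (metis nth_deriv_0)

lemma schwartz_integrable: "schwartz \<phi> \<Longrightarrow> integrable lborel \<phi>"
  by (intro rapid_decay_integrable schwartz_measurable schwartz_rapid_decay)

lemma quadratic_exp_imaginary: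
  "quadratic_exp (- \<i> * complex_of_real \<xi>) x = cis (- (x * \<xi>)) * complex_of_real (gauss x)"
proof -
  have "quadratic_exp (- \<i> * complex_of_real \<xi>) x
      = exp (\<i> * complex_of_real (- (x * \<xi>)) + complex_of_real (- x\<^sup>2 / 2))"
    unfolding quadratic_exp_def by (rule arg_cong[where f = exp]) (simp add: mult_ac)
  then show ?thesis
    by (simp only: exp_add cis_conv_exp gauss_def exp_of_real)
qed

lemma in_L2_integrable_mult_gauss:
  assumes "in_L2 g"
  shows "integrable lborel (\<lambda>x. g x * complex_of_real (gauss x))"
proof (rule Bochner_Integration.integrable_bound)
  show "integrable lborel (\<lambda>x. (cmod (g x))\<^sup>2 + gauss x)"
    using assms integrable_gauss unfolding in_L2_def by simp
  show "(\<lambda>x. g x * complex_of_real (gauss x)) \<in> borel_measurable lborel"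
  proof -
    have [measurable]: "g \<in> borel_measurable borel"
      using assms by (simp add: in_L2_def)
    show ?thesis by simp
  qed
  have "cmod (g x) * gauss x \<le> (cmod (g x))\<^sup>2 + gauss x" for x
  proof -
    have "2 * cmod (g x) \<le> (cmod (g x))\<^sup>2 + 1"
      using zero_le_power2[of "cmod (g x) - 1"] by (simp add: power2_diff)
    then have "cmod (g x) \<le> (cmod (g x))\<^sup>2 + 1"
      using norm_ge_zero[of "g x"] by linarith
    then have "cmod (g x) * gauss x \<le> ((cmod (g x))\<^sup>2 + 1) * gauss x"
      using gauss_pos[of x] by (intro mult_right_mono) simp_all
    also have "\<dots> \<le> (cmod (g x))\<^sup>2 * 1 + gauss x"
      unfolding distrib_right using gauss_le_1[of x] by (intro add_mono mult_left_mono) auto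
    finally show ?thesis by simp
  qed
  then show "AE x in lborel. cmod (g x * complex_of_real (gauss x)) \<le> norm ((cmod (g x))\<^sup>2 + gauss x)"
    using gauss_pos by (intro AE_I2) (simp add: norm_mult less_imp_le)
qed

text \<open>
  By duality and the Bessel inequality, the transform given by the integral satisfies the condition
  that characterises \<open>fourier_L2 v\<close>. Two solutions have equal pairings with all modulated Gaussians, so
  their difference times \<open>gauss\<close> has Fourier transform zero.
\<close>

theorem fourier_L2_eq_fourier:
  assumes v: "in_L2 v" "integrable lborel v"
  shows "AE \<xi> in lborel. fourier_L2 v \<xi> = fourier v \<xi>" and "in_L2 (fourier_L2 v)"
proof -
  define P where "P g \<longleftrightarrow> in_L2 g \<and> (\<forall>\<phi>. schwartz \<phi> \<longrightarrow>
      (\<integral>\<xi>. g \<xi> * \<phi> \<xi> \<partial>lborel) = (\<integral>x. v x * fourier \<phi> x \<partial>lborel))" for g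
  have L2: "in_L2 (fourier v)"
    using v bessel_inequality(1)[OF v(2)] unfolding in_L2_def by simp
  then have "P (fourier v)"
    unfolding P_def using fourier_duality[OF v(2) schwartz_integrable] by blast
  then have P: "P (fourier_L2 v)"
    unfolding fourier_L2_def P_def[symmetric] by (rule someI[where P = P])
  then show L2': "in_L2 (fourier_L2 v)" by (simp add: P_def)
  define d where "d \<xi> = fourier_L2 v \<xi> * complex_of_real (gauss \<xi>)
      - fourier v \<xi> * complex_of_real (gauss \<xi>)" for \<xi>
  have "AE \<xi> in lborel. d \<xi> = 0"
  proof (rule fourier_injective)
    show "integrable lborel d"
      unfolding d_def[abs_def]
      by (intro Bochner_Integration.integrable_diff in_L2_integrable_mult_gauss L2 L2')
    show "fourier d t = 0" for t
    proof -
      define e where "e = quadratic_exp (- \<i> * complex_of_real t)"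
      have *: "fourier (\<lambda>\<xi>. g \<xi> * complex_of_real (gauss \<xi>)) t = (\<integral>\<xi>. g \<xi> * e \<xi> \<partial>lborel)" for g
        by (simp only: fourier_def e_def quadratic_exp_imaginary mult_ac)
      have "fourier d t = (\<integral>\<xi>. fourier_L2 v \<xi> * e \<xi> \<partial>lborel) - (\<integral>\<xi>. fourier v \<xi> * e \<xi> \<partial>lborel)"
        unfolding d_def[abs_def] *[symmetric]
        by (intro fourier_diff in_L2_integrable_mult_gauss L2 L2')
      also have "\<dots> = 0"
        using P \<open>P (fourier v)\<close> schwartz_quadratic_exp unfolding P_def e_def by simp
      finally show ?thesis .
    qed
  qed
  then show "AE \<xi> in lborel. fourier_L2 v \<xi> = fourier v \<xi>"
  proof eventually_elim
    case (elim \<xi>)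
    then show ?case using gauss_pos[of \<xi>] by (simp add: d_def)
  qed
qed

section \<open>The fractional Laplacian as a singular integral\<close>

text \<open>
  Integration by parts: the derivative of the compactly supported function \<open>F\<close> in the proof has
  integral zero.
\<close>

lemma fourier_deriv:
  assumes "test_fun \<phi>"
  shows "fourier (nth_deriv (Suc n) \<phi>) \<xi> = \<i> * complex_of_real \<xi> * fourier (nth_deriv n \<phi>) \<xi>"
proof -
  obtain R where R: "R > 0" "\<And>n x. \<bar>x\<bar> > R \<Longrightarrow> nth_deriv n \<phi> x = 0"
    using test_fun_support[OF assms] by metis
  have smooth: "smooth \<phi>" using assms by (simp add: test_fun_def)
  define F where "F x = cis (- (x * \<xi>)) * nth_deriv n \<phi> x" for x
  define F' where "F' x = cis (- (x * \<xi>)) * nth_deriv (Suc n) \<phi> x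
      - \<i> * complex_of_real \<xi> * (cis (- (x * \<xi>)) * nth_deriv n \<phi> x)" for x
  have deriv: "(F has_vector_derivative F' x) (at x within A)" for x A
  proof -
    have "((\<lambda>z. exp (- \<i> * of_real \<xi> * z)) has_field_derivative
        (- \<i> * of_real \<xi>) * exp (- \<i> * of_real \<xi> * of_real x)) (at (complex_of_real x))"
      by (auto intro!: derivative_eq_intros)
    from has_vector_derivative_real_field[OF this]
    have "((\<lambda>x. cis (- (x * \<xi>))) has_vector_derivative (- \<i> * of_real \<xi>) * cis (- (x * \<xi>))) (at x)"
      by (simp add: cis_conv_exp mult_ac)
    from has_vector_derivative_mult[OF this smooth_has_vector_derivative[OF smooth, of n x]]
    have "(F has_vector_derivative F' x) (at x)"
      by (simp add: F_def[abs_def] F'_def algebra_simps)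
    then show ?thesis by (rule has_vector_derivative_at_within)
  qed
  have "(\<integral>x. indicator {- (R + 1)..R + 1} x *\<^sub>R F' x \<partial>lborel) = F (R + 1) - F (- (R + 1))"
    using R(1) smooth
    by (intro integral_FTC_Icc deriv) (auto simp: F'_def intro!: continuous_intros smooth_continuous)
  also have "\<dots> = 0"
    using R(1) by (simp add: F_def R(2))
  also have "(\<lambda>x. indicator {- (R + 1)..R + 1} x *\<^sub>R F' x) = F'"
    by (auto simp: fun_eq_iff indicator_def F'_def R(2))
  finally have "(\<integral>x. F' x \<partial>lborel) = 0" .
  moreover have "integrable lborel (\<lambda>x. cis (- (x * \<xi>)) * nth_deriv m \<phi> x)" for m
    using integrable_cis_mult[OF test_fun_integrable[OF assms], of "- \<xi>" 0 m] by (simp add: mult.commute)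
  ultimately show ?thesis
    by (simp add: F'_def fourier_def mult.assoc)
qed

lemma fourier_nth_deriv:
  assumes "test_fun \<phi>"
  shows "fourier (nth_deriv n \<phi>) \<xi> = (\<i> * complex_of_real \<xi>) ^ n * fourier \<phi> \<xi>"
  by (induction n) (simp_all add: fourier_deriv[OF assms])

lemma test_fun_fourier_decay:
  assumes "test_fun \<phi>"
  shows "bounded (range (\<lambda>\<xi>. \<xi> ^ k *\<^sub>R fourier \<phi> \<xi>))"
proof -
  have "cmod (\<xi> ^ k *\<^sub>R fourier \<phi> \<xi>) \<le> (\<integral>x. cmod (nth_deriv k \<phi> x) \<partial>lborel)" for \<xi>
    using fourier_bounded[of "nth_deriv k \<phi>" \<xi>]
    by (simp add: fourier_nth_deriv[OF assms] norm_mult norm_power power_abs)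
  then show ?thesis unfolding bounded_iff by blast
qed

text \<open>
  The value at the singularity is \<open>0\<close>, because \<open>0 powr a = 0\<close>.
\<close>

definition hyper_kernel :: "real \<Rightarrow> real" where
  "hyper_kernel h = \<bar>h\<bar> powr (-3/2)"

lemma hyper_kernel_measurable [measurable]: "hyper_kernel \<in> borel_measurable borel"
  unfolding hyper_kernel_def[abs_def] by measurable

lemma hyper_kernel_nonneg: "hyper_kernel h \<ge> 0"
  by (simp add: hyper_kernel_def)

lemma hyper_kernel_minus [simp]: "hyper_kernel (- h) = hyper_kernel h"
  by (simp add: hyper_kernel_def)

lemma integrable_powr_on:
  fixes a :: real
  assumes "((\<lambda>x. x powr a) has_integral I) A" "A \<in> sets borel"
  shows "integrable lborel (\<lambda>x. indicator A x * x powr a)"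
proof -
  have "(\<lambda>x. x powr a) absolutely_integrable_on A"
    using assms by (intro nonnegative_absolutely_integrable_1) auto
  then have "integrable lebesgue (\<lambda>x. indicator A x * x powr a)"
    by (simp add: set_integrable_def)
  then show ?thesis
    using assms(2) by (subst (asm) integrable_completion) auto
qed

text \<open>
  Near \<open>0\<close> the function is \<open>\<bar>h\<bar>\<^sup>-\<^sup>1\<^sup>/\<^sup>2\<close> and far away \<open>\<bar>h\<bar>\<^sup>-\<^sup>3\<^sup>/\<^sup>2\<close>. This is the integrability behind both the
  singular integral, whose numerator is bounded and Lipschitz, and the commutator estimate.
\<close>

lemma integrable_truncated_kernel: "integrable lborel (\<lambda>h. min 1 \<bar>h\<bar> * hyper_kernel h)"
proof -
  \<comment> \<open>\<open>g\<close> dominates the function on the positive half line and its reflection does so on the other.\<close>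
  define g where "g h = indicator {0..1} h * h powr (-1/2) + indicator {1..} h * h powr (-3/2)" for h :: real
  have g: "integrable lborel g"
    unfolding g_def[abs_def]
    using integrable_powr_on[OF has_integral_powr_from_0[of "-1/2" 1]]
      integrable_powr_on[OF has_integral_powr_to_inf[of "-3/2" 1]] by simp
  have g_minus: "integrable lborel (\<lambda>h. g (- h))"
    using lborel_integrable_real_affine[OF g, of "-1" 0] by simp
  have g_nonneg: "g h \<ge> 0" for h
    by (simp add: g_def)
  have pos: "min 1 h * hyper_kernel h \<le> g h" if h: "h > 0" for h
  proof (cases "h \<le> 1")
    case True
    have "min 1 h * hyper_kernel h = h powr 1 * h powr (-3/2)"
      using h True by (simp add: hyper_kernel_def)
    also have "\<dots> = h powr (1 + -3/2)"
      by (rule powr_add[symmetric])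
    also have "\<dots> = h powr (-1/2)" by simp
    also have "\<dots> \<le> g h"
      using h True by (simp add: g_def)
    finally show ?thesis .
  next
    case False
    then show ?thesis by (simp add: g_def hyper_kernel_def)
  qed
  have bound: "min 1 \<bar>h\<bar> * hyper_kernel h \<le> g h + g (- h)" for h
  proof (cases h "0::real" rule: linorder_cases)
    case less
    then show ?thesis using pos[of "- h"] g_nonneg[of h] by simp
  next
    case equal
    then show ?thesis using g_nonneg[of 0] by simp
  next
    case greater
    then show ?thesis using pos[of h] g_nonneg[of "- h"] by simp
  qed
  show ?thesis
  proof (rule Bochner_Integration.integrable_bound)
    show "integrable lborel (\<lambda>h. g h + g (- h))"
      using g g_minus by (rule Bochner_Integration.integrable_add)
    have "norm (min 1 \<bar>h\<bar> * hyper_kernel h) \<le> norm (g h + g (- h))" for h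
      using order_trans[OF bound[of h] abs_ge_self] hyper_kernel_nonneg[of h] by simp
    then show "AE h in lborel. norm (min 1 \<bar>h\<bar> * hyper_kernel h) \<le> norm (g h + g (- h))"
      by (rule AE_I2)
  qed measurable
qed

text \<open>
  The kernel is homogeneous of degree \<open>-3/2\<close> and \<open>dh\<close> scales with degree \<open>1\<close>, so the dilation by
  \<open>\<xi>\<close> leaves the factor \<open>\<bar>\<xi>\<bar>\<^sup>1\<^sup>/\<^sup>2\<close>.
\<close>

lemma kernel_scaling:
  fixes F :: "real \<Rightarrow> 'a :: {banach, second_countable_topology}"
  assumes "F 0 = 0"
  shows "(\<integral>h. hyper_kernel h *\<^sub>R F (h * \<xi>) \<partial>lborel)
       = (\<bar>\<xi>\<bar> powr (1/2)) *\<^sub>R (\<integral>h. hyper_kernel h *\<^sub>R F h \<partial>lborel)"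
proof (cases "\<xi> = 0")
  case False
  have kernel: "hyper_kernel (h * \<xi>) = \<bar>\<xi>\<bar> powr (-3/2) * hyper_kernel h" for h
    by (simp add: hyper_kernel_def abs_mult powr_mult)
  have "(\<integral>h. hyper_kernel h *\<^sub>R F h \<partial>lborel)
      = \<bar>\<xi>\<bar> *\<^sub>R (\<integral>h. hyper_kernel (\<xi> * h) *\<^sub>R F (\<xi> * h) \<partial>lborel)"
    using lborel_integral_real_affine[OF False, of "\<lambda>h. hyper_kernel h *\<^sub>R F h" 0] by simp
  also have "\<dots> = (\<bar>\<xi>\<bar> * \<bar>\<xi>\<bar> powr (-3/2)) *\<^sub>R (\<integral>h. hyper_kernel h *\<^sub>R F (h * \<xi>) \<partial>lborel)"
    by (simp only: kernel mult.commute[of \<xi>] integral_scaleR_right flip: scaleR_scaleR)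
  also have "\<bar>\<xi>\<bar> * \<bar>\<xi>\<bar> powr (-3/2) = \<bar>\<xi>\<bar> powr (-1/2)"
    using False powr_add[of "\<bar>\<xi>\<bar>" 1 "-3/2"] by simp
  finally show ?thesis
    using False by (simp flip: powr_add)
qed (use assms in simp)

lemma one_minus_cis_bound: "cmod (1 - cis t) \<le> 2 * min 1 \<bar>t\<bar>"
proof -
  have "cmod (1 - cis t) \<le> \<bar>t\<bar>"
    using iexp_approx1[of t 0] by (simp add: cis_conv_exp norm_minus_commute)
  moreover have "cmod (1 - cis t) \<le> 2"
    using norm_triangle_ineq4[of 1 "cis t"] by simp
  ultimately show ?thesis by auto
qed

lemma integrable_one_minus_cis: "integrable lborel (\<lambda>h. hyper_kernel h *\<^sub>R (1 - cis (h * \<xi>)))"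
proof (rule Bochner_Integration.integrable_bound)
  show "integrable lborel (\<lambda>h. 2 * (1 + \<bar>\<xi>\<bar>) * (min 1 \<bar>h\<bar> * hyper_kernel h))"
    using integrable_truncated_kernel by (rule integrable_mult_right)
  have "hyper_kernel h * cmod (1 - cis (h * \<xi>)) \<le> 2 * (1 + \<bar>\<xi>\<bar>) * (min 1 \<bar>h\<bar> * hyper_kernel h)" for h
  proof -
    have "min 1 \<bar>h * \<xi>\<bar> \<le> (1 + \<bar>\<xi>\<bar>) * min 1 \<bar>h\<bar>"
    proof (cases "\<bar>h\<bar> \<le> 1")
      case True
      have "min 1 \<bar>h * \<xi>\<bar> \<le> \<bar>h\<bar> * \<bar>\<xi>\<bar>"
        by (simp add: abs_mult)
      also have "\<dots> \<le> \<bar>h\<bar> + \<bar>h\<bar> * \<bar>\<xi>\<bar>" by simp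
      finally show ?thesis using True by (simp add: algebra_simps)
    qed simp
    then have "cmod (1 - cis (h * \<xi>)) \<le> 2 * ((1 + \<bar>\<xi>\<bar>) * min 1 \<bar>h\<bar>)"
      using one_minus_cis_bound[of "h * \<xi>"] by linarith
    from mult_left_mono[OF this hyper_kernel_nonneg[of h]] show ?thesis
      by (simp only: mult_ac)
  qed
  then show "AE h in lborel. norm (hyper_kernel h *\<^sub>R (1 - cis (h * \<xi>)))
      \<le> norm (2 * (1 + \<bar>\<xi>\<bar>) * (min 1 \<bar>h\<bar> * hyper_kernel h))"
    using hyper_kernel_nonneg by (intro AE_I2) simp
qed measurable

text \<open>
  The constant \<open>A\<close> that relates the multiplier \<open>\<bar>\<xi>\<bar>\<^sup>1\<^sup>/\<^sup>2\<close> to the kernel. It is carried along as a factor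
  and divided out in the final estimate, for which it suffices that it does not vanish.
\<close>

definition symbol_const :: complex where
  "symbol_const = (\<integral>h. hyper_kernel h *\<^sub>R (1 - cis h) \<partial>lborel)"

text \<open>
  The real part is the integral of \<open>hyper_kernel h * (1 - cos h)\<close>, which is nonnegative, and positive
  for \<open>1 \<le> h \<le> 2\<close>.
\<close>

lemma symbol_const_nonzero: "symbol_const \<noteq> 0"
proof
  assume "symbol_const = 0"
  have int: "integrable lborel (\<lambda>h. hyper_kernel h *\<^sub>R (1 - cis h))"
    using integrable_one_minus_cis[of 1] by simp
  have "(\<integral>h. hyper_kernel h * (1 - cos h) \<partial>lborel) = Re symbol_const"
    unfolding symbol_const_def by (subst integral_Re[OF int, symmetric]) simp
  also have "\<dots> = 0" using \<open>symbol_const = 0\<close> by simp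
  finally have "AE h in lborel. hyper_kernel h * (1 - cos h) = 0"
    using integrable_Re[OF int] hyper_kernel_nonneg
    by (subst (asm) integral_nonneg_eq_0_iff_AE) auto
  then have "AE h in lborel. h \<notin> {1..2::real}"
  proof eventually_elim
    case (elim h)
    show ?case
    proof
      assume h: "h \<in> {1..2}"
      then have "cos h < cos 0"
        using pi_gt3 by (intro cos_monotone_0_pi) auto
      moreover have "hyper_kernel h > 0"
        using h by (simp add: hyper_kernel_def)
      ultimately show False using elim by simp
    qed
  qed
  then have "{1..2::real} \<in> null_sets lborel"
    by (subst (asm) AE_iff_null_sets[symmetric]) auto
  then show False by (simp add: null_sets_def)
qed

lemma symbol_formula:
  "(\<integral>h. hyper_kernel h *\<^sub>R (1 - cis (h * \<xi>)) \<partial>lborel) = (\<bar>\<xi>\<bar> powr (1/2)) *\<^sub>R symbol_const"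
  unfolding symbol_const_def by (rule kernel_scaling) simp

text \<open>
  Write the multiplier as an integral over \<open>h\<close> by \<open>symbol_formula\<close> and exchange the integrals. For
  fixed \<open>h\<close> the integral over \<open>\<xi>\<close> is then Fourier inversion at \<open>x\<close> and at \<open>x + h\<close>. By scaling, the
  integral of the absolute value over \<open>h\<close> is a multiple of \<open>\<bar>\<xi>\<bar>\<^sup>1\<^sup>/\<^sup>2 * cmod (fourier \<phi> \<xi>)\<close>, so the
  weighted integrability of the transform is what Fubini's theorem asks for.
\<close>

theorem frac_laplacian_singular_integral:
  assumes \<phi>: "integrable lborel \<phi>" and cont: "continuous_on UNIV \<phi>"
    and bounded: "\<And>x. cmod (\<phi> x) \<le> B" and f\<phi>: "integrable lborel (fourier \<phi>)"
    and weighted: "integrable lborel (\<lambda>\<xi>. complex_of_real (\<bar>\<xi>\<bar> powr (1/2)) * fourier \<phi> \<xi>)"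
  shows "integrable lborel (\<lambda>h. hyper_kernel h *\<^sub>R (\<phi> x - \<phi> (x + h)))"
    and "symbol_const * frac_laplacian (1/4) \<phi> x
       = (\<integral>h. hyper_kernel h *\<^sub>R (\<phi> x - \<phi> (x + h)) \<partial>lborel)"
proof -
  have [measurable]: "fourier \<phi> \<in> borel_measurable borel"
    using f\<phi> by (auto dest: borel_measurable_integrable)
  define H where "H \<xi> h = hyper_kernel h *\<^sub>R (1 - cis (h * \<xi>)) * (cis (x * \<xi>) * fourier \<phi> \<xi>)" for \<xi> h
  define b where "b = (\<integral>h. hyper_kernel h *\<^sub>R cmod (1 - cis h) \<partial>lborel)"
  have H: "integrable (lborel \<Otimes>\<^sub>M lborel) (case_prod H)"
  proof (rule lborel_pair.Fubini_integrable)
    show "case_prod H \<in> borel_measurable (lborel \<Otimes>\<^sub>M lborel)"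
      unfolding H_def[abs_def] by measurable
    have "(\<integral>h. norm (case_prod H (\<xi>, h)) \<partial>lborel)
        = b * cmod (complex_of_real (\<bar>\<xi>\<bar> powr (1/2)) * fourier \<phi> \<xi>)" for \<xi>
    proof -
      have "(\<integral>h. norm (case_prod H (\<xi>, h)) \<partial>lborel)
          = (\<integral>h. hyper_kernel h *\<^sub>R cmod (1 - cis (h * \<xi>)) * cmod (fourier \<phi> \<xi>) \<partial>lborel)"
        unfolding H_def using hyper_kernel_nonneg
        by (intro Bochner_Integration.integral_cong refl) (simp add: norm_mult)
      also have "\<dots> = (\<bar>\<xi>\<bar> powr (1/2)) *\<^sub>R b * cmod (fourier \<phi> \<xi>)"
        unfolding b_def by (subst integral_mult_left_zero, subst kernel_scaling) simp_all
      finally show ?thesis by (simp add: norm_mult)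
    qed
    then show "integrable lborel (\<lambda>\<xi>. \<integral>h. norm (case_prod H (\<xi>, h)) \<partial>lborel)"
      using weighted by (simp only: integrable_mult_right integrable_norm)
    show "AE \<xi> in lborel. integrable lborel (\<lambda>h. case_prod H (\<xi>, h))"
      unfolding H_def prod.case
      by (intro AE_I2 integrable_mult_left integrable_one_minus_cis)
  qed
  have inner_h: "(\<integral>h. H \<xi> h \<partial>lborel)
      = symbol_const * (cis (x * \<xi>) * (complex_of_real (\<bar>\<xi>\<bar> powr (1/2)) * fourier \<phi> \<xi>))" for \<xi>
    unfolding H_def
    by (subst integral_mult_left_zero, subst symbol_formula) (simp add: scaleR_conv_of_real mult_ac)
  have inner_\<xi>: "(\<integral>\<xi>. H \<xi> h \<partial>lborel)
      = complex_of_real (2 * pi) * hyper_kernel h *\<^sub>R (\<phi> x - \<phi> (x + h))" for h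
  proof -
    have inv: "(\<integral>\<xi>. cis (y * \<xi>) * fourier \<phi> \<xi> \<partial>lborel) = complex_of_real (2 * pi) * \<phi> y" for y
      using fourier_inversion[OF \<phi> cont bounded f\<phi>, of y] by (simp add: inv_fourier_def field_simps)
    have int: "integrable lborel (\<lambda>\<xi>. cis (y * \<xi>) * fourier \<phi> \<xi>)" for y
      using integrable_cis_mult[OF f\<phi>, of y 0] by simp
    have "(\<integral>\<xi>. H \<xi> h \<partial>lborel)
        = (\<integral>\<xi>. hyper_kernel h *\<^sub>R (cis (x * \<xi>) * fourier \<phi> \<xi> - cis ((x + h) * \<xi>) * fourier \<phi> \<xi>) \<partial>lborel)"
      unfolding H_def by (intro Bochner_Integration.integral_cong refl)
        (simp add: algebra_simps flip: cis_mult)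
    also have "\<dots> = hyper_kernel h *\<^sub>R (complex_of_real (2 * pi) * \<phi> x - complex_of_real (2 * pi) * \<phi> (x + h))"
      by (subst integral_scaleR_right, subst Bochner_Integration.integral_diff[OF int int]) (simp only: inv)
    finally show ?thesis by (simp add: algebra_simps)
  qed
  have "integrable lborel (\<lambda>h. \<integral>\<xi>. H \<xi> h \<partial>lborel)"
    using lborel_pair.integrable_snd[OF H] .
  then have "integrable lborel (\<lambda>h. 1 / complex_of_real (2 * pi) *
      (complex_of_real (2 * pi) * hyper_kernel h *\<^sub>R (\<phi> x - \<phi> (x + h))))"
    unfolding inner_\<xi> by (rule integrable_mult_right)
  then show "integrable lborel (\<lambda>h. hyper_kernel h *\<^sub>R (\<phi> x - \<phi> (x + h)))"
    by simp
  have "complex_of_real (2 * pi) * (\<integral>h. hyper_kernel h *\<^sub>R (\<phi> x - \<phi> (x + h)) \<partial>lborel)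
      = (\<integral>h. (\<integral>\<xi>. H \<xi> h \<partial>lborel) \<partial>lborel)"
    unfolding inner_\<xi> by (simp only: integral_mult_right_zero mult_scaleR_right[symmetric])
  also have "\<dots> = (\<integral>\<xi>. (\<integral>h. H \<xi> h \<partial>lborel) \<partial>lborel)"
    by (rule lborel_pair.Fubini_integral[OF H])
  also have "\<dots> = complex_of_real (2 * pi) * (symbol_const * frac_laplacian (1/4) \<phi> x)"
    unfolding inner_h frac_laplacian_def inv_fourier_def by simp
  finally show "symbol_const * frac_laplacian (1/4) \<phi> x
       = (\<integral>h. hyper_kernel h *\<^sub>R (\<phi> x - \<phi> (x + h)) \<partial>lborel)"
    by simp
qed

section \<open>The commutator with a cutoff\<close>

lemma test_fun_lipschitz:
  assumes "test_fun \<eta>"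
  obtains L where "L \<ge> 0" "\<And>x y. cmod (\<eta> x - \<eta> y) \<le> L * \<bar>x - y\<bar>"
proof -
  have smooth: "smooth \<eta>" using assms by (simp add: test_fun_def)
  obtain L where L: "\<And>x. cmod (nth_deriv 1 \<eta> x) \<le> L"
    using test_fun_bounded[OF assms, of 0 1] unfolding bounded_iff by auto
  have "L \<ge> 0" using order_trans[OF norm_ge_zero L] .
  moreover have "cmod (\<eta> x - \<eta> y) \<le> L * norm (x - y)" for x y
  proof (rule differentiable_bound[where S = UNIV])
    show "(\<eta> has_derivative (\<lambda>h. h *\<^sub>R nth_deriv 1 \<eta> x)) (at x within UNIV)" for x
      using smooth_has_vector_derivative[OF smooth, of 0 x] by (simp add: has_vector_derivative_def)
    show "onorm (\<lambda>h. h *\<^sub>R nth_deriv 1 \<eta> x) \<le> L" for x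
      using \<open>L \<ge> 0\<close> L[of x] by (intro onorm_bound) (simp_all add: mult.commute[of L] mult_left_mono)
  qed auto
  ultimately show ?thesis using that by simp
qed

text \<open>
  The factor \<open>min 1 \<bar>h\<bar>\<close> combines the Lipschitz bound with the supremum bound. The indicators record
  that the increment vanishes unless one of the two points lies in the support.
\<close>

lemma test_fun_increment:
  assumes "test_fun \<eta>"
  obtains B R where "B \<ge> 0" "R > 0"
    "\<And>x h. cmod (\<eta> x - \<eta> (x + h))
        \<le> B * min 1 \<bar>h\<bar> * (indicator {-R..R} x + indicator {-R..R} (x + h))"
proof -
  obtain R where R: "R > 0" "\<And>n x. \<bar>x\<bar> > R \<Longrightarrow> nth_deriv n \<eta> x = 0"
    using test_fun_support[OF assms] by metis
  obtain B0 where B0: "\<And>x. cmod (\<eta> x) \<le> B0"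
    using test_fun_bounded[OF assms, of 0 0] unfolding bounded_iff by auto
  obtain L where L: "L \<ge> 0" "\<And>x y. cmod (\<eta> x - \<eta> y) \<le> L * \<bar>x - y\<bar>"
    using test_fun_lipschitz[OF assms] by metis
  define B where "B = 2 * B0 + L"
  have "B0 \<ge> 0" using order_trans[OF norm_ge_zero B0] .
  then have "B \<ge> 0" using L(1) by (simp add: B_def)
  have all: "cmod (\<eta> x - \<eta> (x + h)) \<le> B * min 1 \<bar>h\<bar>" for x h
  proof (cases "\<bar>h\<bar> \<le> 1")
    case True
    have "cmod (\<eta> x - \<eta> (x + h)) \<le> L * \<bar>h\<bar>"
      using L(2)[of x "x + h"] by simp
    also have "\<dots> \<le> B * \<bar>h\<bar>"
      using \<open>B0 \<ge> 0\<close> by (intro mult_right_mono) (simp_all add: B_def)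
    finally show ?thesis using True by simp
  next
    case False
    have "cmod (\<eta> x - \<eta> (x + h)) \<le> B0 + B0"
      using norm_triangle_ineq4[of "\<eta> x" "\<eta> (x + h)"] B0[of x] B0[of "x + h"] by linarith
    then show ?thesis using False L(1) by (simp add: B_def)
  qed
  have "cmod (\<eta> x - \<eta> (x + h))
      \<le> B * min 1 \<bar>h\<bar> * (indicator {-R..R} x + indicator {-R..R} (x + h))" for x h
  proof (cases "x \<in> {-R..R} \<or> x + h \<in> {-R..R}")
    case True
    then have "(1::real) \<le> indicator {-R..R} x + indicator {-R..R} (x + h)"
      by (auto simp: indicator_def)
    from mult_left_mono[OF this, of "B * min 1 \<bar>h\<bar>"] \<open>B \<ge> 0\<close> all[of x h]
    show ?thesis by simp
  next
    case False
    then have "\<bar>x\<bar> > R" "\<bar>x + h\<bar> > R" by auto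
    then have "\<eta> x = 0" "\<eta> (x + h) = 0" using R(2)[of _ 0] by auto
    then show ?thesis using False by simp
  qed
  with \<open>B \<ge> 0\<close> R(1) show ?thesis using that by blast
qed

definition commutator_kernel :: "(real \<Rightarrow> complex) \<Rightarrow> real \<Rightarrow> real \<Rightarrow> complex" where
  "commutator_kernel \<eta> x y = hyper_kernel (y - x) *\<^sub>R (\<eta> x - \<eta> y)"

lemma commutator_kernel_measurable:
  assumes [measurable]: "\<eta> \<in> borel_measurable borel"
  shows "case_prod (commutator_kernel \<eta>) \<in> borel_measurable (lborel \<Otimes>\<^sub>M lborel)"
  unfolding commutator_kernel_def[abs_def] by measurable

lemma norm_commutator_kernel_sym: "cmod (commutator_kernel \<eta> x y) = cmod (commutator_kernel \<eta> y x)"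
  using hyper_kernel_minus[of "x - y"] by (simp add: commutator_kernel_def norm_minus_commute)

lemma test_fun_measurable: "test_fun \<eta> \<Longrightarrow> \<eta> \<in> borel_measurable borel"
  by (simp add: test_fun_imp_schwartz schwartz_measurable)

text \<open>
  With \<open>y = x + h\<close> the absolute value of the kernel is at most an integrable function of \<open>h\<close> times
  the indicators that \<open>x\<close> or \<open>x + h\<close> lies in an interval. Integrating over \<open>h\<close> alone and bounding the
  indicators by \<open>1\<close> gives the uniform bound; integrating over \<open>x\<close> first gives the length of the
  interval, hence the joint integrability.
\<close>

lemma commutator_kernel_integrable:
  assumes \<eta>: "test_fun \<eta>"
  obtains M where "M \<ge> 0"
    "\<And>x. (\<integral>\<^sup>+y. ennreal (cmod (commutator_kernel \<eta> x y)) \<partial>lborel) \<le> ennreal M"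
    "integrable (lborel \<Otimes>\<^sub>M lborel) (case_prod (commutator_kernel \<eta>))"
proof -
  note test_fun_measurable[OF \<eta>, measurable]
  note commutator_kernel_measurable[OF test_fun_measurable[OF \<eta>], measurable]
  obtain B R where "B \<ge> 0" "R > 0" and incr: "\<And>x h. cmod (\<eta> x - \<eta> (x + h))
        \<le> B * min 1 \<bar>h\<bar> * (indicator {-R..R} x + indicator {-R..R} (x + h))"
    using test_fun_increment[OF \<eta>] by metis
  define k where "k h = B * (min 1 \<bar>h\<bar> * hyper_kernel h)" for h
  have [measurable]: "k \<in> borel_measurable borel" unfolding k_def[abs_def] by measurable
  have k_nonneg: "k h \<ge> 0" for h
    using \<open>B \<ge> 0\<close> hyper_kernel_nonneg by (simp add: k_def)
  have k: "integrable lborel k"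
    unfolding k_def[abs_def] using integrable_truncated_kernel by (rule integrable_mult_right)
  define \<kappa> where "\<kappa> = (\<integral>h. k h \<partial>lborel)"
  have "\<kappa> \<ge> 0" unfolding \<kappa>_def using k_nonneg by (intro integral_nonneg_AE) auto
  have \<kappa>: "(\<integral>\<^sup>+h. ennreal (k h) \<partial>lborel) = ennreal \<kappa>"
    unfolding \<kappa>_def using k k_nonneg by (intro nn_integral_eq_integral) auto
  define J :: "real \<Rightarrow> ennreal" where "J = indicator {-R..R}"
  have [measurable]: "J \<in> borel_measurable borel" unfolding J_def by measurable
  have J: "(\<integral>\<^sup>+x. J x \<partial>lborel) = ennreal (2 * R)"
    unfolding J_def using \<open>R > 0\<close> by simp
  have J_shift: "(\<integral>\<^sup>+x. J (x + h) \<partial>lborel) = ennreal (2 * R)" for h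
    unfolding J[symmetric] by (subst (2) nn_integral_real_affine[of _ 1 h]) (auto simp: add.commute)
  have bound: "ennreal (cmod (commutator_kernel \<eta> x (x + h))) \<le> ennreal (k h) * (J x + J (x + h))" for x h
  proof -
    have "cmod (commutator_kernel \<eta> x (x + h)) = hyper_kernel h * cmod (\<eta> x - \<eta> (x + h))"
      using hyper_kernel_nonneg by (simp add: commutator_kernel_def)
    also have "\<dots> \<le> hyper_kernel h * (B * min 1 \<bar>h\<bar> * (indicator {-R..R} x + indicator {-R..R} (x + h)))"
      by (intro mult_left_mono incr hyper_kernel_nonneg)
    also have "\<dots> = k h * (indicator {-R..R} x + indicator {-R..R} (x + h))"
      by (simp add: k_def mult_ac)
    finally have "ennreal (cmod (commutator_kernel \<eta> x (x + h)))
        \<le> ennreal (k h * (indicator {-R..R} x + indicator {-R..R} (x + h)))"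
      by (rule ennreal_leI)
    also have "\<dots> = ennreal (k h) * (J x + J (x + h))"
      using k_nonneg[of h] by (simp add: J_def ennreal_mult ennreal_plus ennreal_indicator)
    finally show ?thesis .
  qed
  have row: "(\<integral>\<^sup>+y. ennreal (cmod (commutator_kernel \<eta> x y)) \<partial>lborel)
      \<le> (\<integral>\<^sup>+h. ennreal (k h) * (J x + J (x + h)) \<partial>lborel)" for x
  proof -
    have "(\<integral>\<^sup>+y. ennreal (cmod (commutator_kernel \<eta> x y)) \<partial>lborel)
        = (\<integral>\<^sup>+h. ennreal (cmod (commutator_kernel \<eta> x (x + h))) \<partial>lborel)"
      by (subst nn_integral_real_affine[of _ 1 x]) auto
    also have "\<dots> \<le> (\<integral>\<^sup>+h. ennreal (k h) * (J x + J (x + h)) \<partial>lborel)"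
      by (intro nn_integral_mono bound)
    finally show ?thesis .
  qed
  have "(\<integral>\<^sup>+y. ennreal (cmod (commutator_kernel \<eta> x y)) \<partial>lborel) \<le> ennreal (\<kappa> * 2)" for x
  proof -
    have "(\<integral>\<^sup>+h. ennreal (k h) * (J x + J (x + h)) \<partial>lborel) \<le> (\<integral>\<^sup>+h. ennreal (k h) * 2 \<partial>lborel)"
      by (intro nn_integral_mono mult_left_mono) (auto simp: J_def indicator_def)
    also have "\<dots> = ennreal \<kappa> * 2"
      by (subst nn_integral_multc) (auto simp: \<kappa>)
    also have "\<dots> = ennreal (\<kappa> * 2)"
      using \<open>\<kappa> \<ge> 0\<close> by (simp add: ennreal_mult)
    finally show ?thesis using row[of x] by (rule order_trans[rotated])
  qed
  moreover have "integrable (lborel \<Otimes>\<^sub>M lborel) (case_prod (commutator_kernel \<eta>))"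
  proof (rule integrableI_bounded)
    have "(\<integral>\<^sup>+p. ennreal (norm (case_prod (commutator_kernel \<eta>) p)) \<partial>(lborel \<Otimes>\<^sub>M lborel))
        = (\<integral>\<^sup>+x. (\<integral>\<^sup>+y. ennreal (cmod (commutator_kernel \<eta> x y)) \<partial>lborel) \<partial>lborel)"
      by (subst lborel.nn_integral_fst[symmetric]) auto
    also have "\<dots> \<le> (\<integral>\<^sup>+x. (\<integral>\<^sup>+h. ennreal (k h) * (J x + J (x + h)) \<partial>lborel) \<partial>lborel)"
      by (intro nn_integral_mono row)
    also have "\<dots> = (\<integral>\<^sup>+h. (\<integral>\<^sup>+x. ennreal (k h) * (J x + J (x + h)) \<partial>lborel) \<partial>lborel)"
      by (rule lborel_pair.Fubini') measurable
    also have "\<dots> = (\<integral>\<^sup>+h. ennreal (k h) * (ennreal (2 * R) + ennreal (2 * R)) \<partial>lborel)"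
      by (simp add: nn_integral_cmult nn_integral_add J J_shift)
    also have "\<dots> = ennreal \<kappa> * (ennreal (2 * R) + ennreal (2 * R))"
      by (subst nn_integral_multc) (auto simp: \<kappa>)
    also have "\<dots> < \<infinity>"
      by (simp add: ennreal_mult_less_top)
    finally show "(\<integral>\<^sup>+p. ennreal (norm (case_prod (commutator_kernel \<eta>) p)) \<partial>(lborel \<Otimes>\<^sub>M lborel)) < \<infinity>" .
  qed measurable
  ultimately show ?thesis using that[of "\<kappa> * 2"] \<open>\<kappa> \<ge> 0\<close> by simp
qed

text \<open>
  The column integrals \<open>G y\<close> of the absolute kernel are bounded by \<open>M\<close> and integrable, so \<open>G\<^sup>2 \<le> M G\<close> is
  integrable, and \<open>U * G\<close> dominates the integral of \<open>u x * commutator_kernel \<eta> x y\<close> over \<open>x\<close>.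
\<close>

lemma commutator_adjoint_bounded:
  assumes \<eta>: "test_fun \<eta>"
  obtains N where "N \<ge> 0" and
    "\<And>u U. \<lbrakk>u \<in> borel_measurable borel; \<And>x. cmod (u x) \<le> U\<rbrakk> \<Longrightarrow>
       integrable lborel (\<lambda>y. \<integral>x. u x * commutator_kernel \<eta> x y \<partial>lborel) \<and>
       integrable lborel (\<lambda>y. (cmod (\<integral>x. u x * commutator_kernel \<eta> x y \<partial>lborel))\<^sup>2) \<and>
       (\<integral>y. (cmod (\<integral>x. u x * commutator_kernel \<eta> x y \<partial>lborel))\<^sup>2 \<partial>lborel) \<le> N * U\<^sup>2"
proof -
  note test_fun_measurable[OF \<eta>, measurable]
  note commutator_kernel_measurable[OF test_fun_measurable[OF \<eta>], measurable]
  obtain M where "M \<ge> 0" and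
    row: "\<And>x. (\<integral>\<^sup>+y. ennreal (cmod (commutator_kernel \<eta> x y)) \<partial>lborel) \<le> ennreal M" and
    K: "integrable (lborel \<Otimes>\<^sub>M lborel) (case_prod (commutator_kernel \<eta>))"
    using commutator_kernel_integrable[OF \<eta>] by metis
  define G where "G y = (\<integral>x. cmod (commutator_kernel \<eta> x y) \<partial>lborel)" for y
  have norm_K: "integrable (lborel \<Otimes>\<^sub>M lborel) (\<lambda>(x, y). cmod (commutator_kernel \<eta> x y))"
    using integrable_norm[OF K] by (simp add: case_prod_unfold)
  have G: "integrable lborel G"
    unfolding G_def[abs_def] by (rule lborel_pair.integrable_snd[OF norm_K])
  have col: "integrable lborel (\<lambda>x. commutator_kernel \<eta> x y)" for y
  proof (rule integrableI_bounded)
    show "(\<integral>\<^sup>+x. ennreal (norm (commutator_kernel \<eta> x y)) \<partial>lborel) < \<infinity>"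
      using order.strict_trans1[OF row[of y] ennreal_less_top]
      by (simp add: norm_commutator_kernel_sym[of \<eta> _ y])
  qed measurable
  have G_nonneg: "G y \<ge> 0" for y
    unfolding G_def by (intro integral_nonneg_AE) auto
  have G_le: "G y \<le> M" for y
  proof -
    have "ennreal (G y) = (\<integral>\<^sup>+x. ennreal (cmod (commutator_kernel \<eta> x y)) \<partial>lborel)"
      unfolding G_def using col[of y] by (intro nn_integral_eq_integral[symmetric]) auto
    also have "\<dots> \<le> ennreal M"
      using row[of y] by (simp add: norm_commutator_kernel_sym[of \<eta> _ y])
    finally show ?thesis using \<open>M \<ge> 0\<close> by simp
  qed
  define N where "N = M * (\<integral>y. G y \<partial>lborel)"
  have "N \<ge> 0"
    unfolding N_def using \<open>M \<ge> 0\<close> G_nonneg by (intro mult_nonneg_nonneg integral_nonneg_AE) auto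
  moreover have
    "integrable lborel (\<lambda>y. \<integral>x. u x * commutator_kernel \<eta> x y \<partial>lborel) \<and>
     integrable lborel (\<lambda>y. (cmod (\<integral>x. u x * commutator_kernel \<eta> x y \<partial>lborel))\<^sup>2) \<and>
     (\<integral>y. (cmod (\<integral>x. u x * commutator_kernel \<eta> x y \<partial>lborel))\<^sup>2 \<partial>lborel) \<le> N * U\<^sup>2"
    if u [measurable]: "u \<in> borel_measurable borel" and U: "\<And>x. cmod (u x) \<le> U" for u U
  proof -
    define E where "E y = (\<integral>x. u x * commutator_kernel \<eta> x y \<partial>lborel)" for y
    have [measurable]: "E \<in> borel_measurable borel"
      unfolding E_def[abs_def] by measurable
    have "U \<ge> 0" using order_trans[OF norm_ge_zero U] .
    have E_le: "cmod (E y) \<le> U * G y" for y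
    proof -
      have "integrable lborel (\<lambda>x. commutator_kernel \<eta> x y * u x)"
        by (rule integrable_mult_bounded[OF col u U])
      then have "integrable lborel (\<lambda>x. cmod (u x * commutator_kernel \<eta> x y))"
        by (subst mult.commute) (rule integrable_norm)
      then have "(\<integral>x. cmod (u x * commutator_kernel \<eta> x y) \<partial>lborel)
          \<le> (\<integral>x. U * cmod (commutator_kernel \<eta> x y) \<partial>lborel)"
        using col by (intro integral_mono) (simp_all add: norm_mult U mult_right_mono)
      then show ?thesis
        unfolding E_def G_def integral_mult_right_zero[symmetric]
        by (rule order_trans[OF integral_norm_bound])
    qed
    have int_E: "integrable lborel E"
    proof (rule Bochner_Integration.integrable_bound)
      show "integrable lborel (\<lambda>y. U * G y)" using G by simp
      show "AE y in lborel. cmod (E y) \<le> norm (U * G y)"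
        by (intro AE_I2 order_trans[OF E_le]) simp
    qed measurable
    have sq: "(cmod (E y))\<^sup>2 \<le> U\<^sup>2 * M * G y" for y
    proof -
      have "(cmod (E y))\<^sup>2 \<le> (U * G y)\<^sup>2"
        by (intro power_mono E_le) simp
      also have "\<dots> = U\<^sup>2 * (G y * G y)"
        by (simp add: power2_eq_square)
      also have "\<dots> \<le> U\<^sup>2 * (M * G y)"
        by (intro mult_left_mono mult_right_mono G_le G_nonneg) simp
      finally show ?thesis by (simp add: mult.assoc)
    qed
    have int: "integrable lborel (\<lambda>y. U\<^sup>2 * M * G y)"
      using G by simp
    have int_sq: "integrable lborel (\<lambda>y. (cmod (E y))\<^sup>2)"
    proof (rule Bochner_Integration.integrable_bound[OF int])
      show "AE y in lborel. norm ((cmod (E y))\<^sup>2) \<le> norm (U\<^sup>2 * M * G y)"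
        using sq by (intro AE_I2) (simp add: order_trans[OF _ abs_ge_self])
    qed measurable
    have "(\<integral>y. (cmod (E y))\<^sup>2 \<partial>lborel) \<le> (\<integral>y. U\<^sup>2 * M * G y \<partial>lborel)"
      by (intro integral_mono int int_sq sq)
    then have "(\<integral>y. (cmod (E y))\<^sup>2 \<partial>lborel) \<le> N * U\<^sup>2"
      by (simp add: N_def mult_ac)
    with int_E int_sq show ?thesis
      unfolding E_def by blast
  qed
  ultimately show ?thesis using that by blast
qed

lemma commutator_pairing:
  assumes \<eta>: "test_fun \<eta>"
    and u [measurable]: "u \<in> borel_measurable borel" and U: "\<And>x. cmod (u x) \<le> U"
    and \<psi> [measurable]: "\<psi> \<in> borel_measurable borel" and V: "\<And>x. cmod (\<psi> x) \<le> V"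
  shows "integrable lborel (\<lambda>x. u x * (\<integral>y. commutator_kernel \<eta> x y * \<psi> y \<partial>lborel))"
    and "(\<integral>x. u x * (\<integral>y. commutator_kernel \<eta> x y * \<psi> y \<partial>lborel) \<partial>lborel)
       = (\<integral>y. (\<integral>x. u x * commutator_kernel \<eta> x y \<partial>lborel) * \<psi> y \<partial>lborel)"
proof -
  note commutator_kernel_measurable[OF test_fun_measurable[OF \<eta>], measurable]
  define F where "F x y = u x * commutator_kernel \<eta> x y * \<psi> y" for x y
  have "U \<ge> 0" using order_trans[OF norm_ge_zero U] .
  have F: "integrable (lborel \<Otimes>\<^sub>M lborel) (case_prod F)"
  proof (rule Bochner_Integration.integrable_bound)
    show "integrable (lborel \<Otimes>\<^sub>M lborel) (\<lambda>p. (U * V) *\<^sub>R case_prod (commutator_kernel \<eta>) p)"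
      using commutator_kernel_integrable[OF \<eta>] by (metis integrable_scaleR_right)
    show "case_prod F \<in> borel_measurable (lborel \<Otimes>\<^sub>M lborel)"
      unfolding F_def[abs_def] by measurable
    have "cmod (F x y) \<le> U * V * cmod (commutator_kernel \<eta> x y)" for x y
    proof -
      have "cmod (F x y) = (cmod (u x) * cmod (\<psi> y)) * cmod (commutator_kernel \<eta> x y)"
        by (simp add: F_def norm_mult)
      also have "\<dots> \<le> (U * V) * cmod (commutator_kernel \<eta> x y)"
        using \<open>U \<ge> 0\<close> by (intro mult_right_mono mult_mono U V) auto
      finally show ?thesis .
    qed
    then show "AE p in lborel \<Otimes>\<^sub>M lborel. norm (case_prod F p)
        \<le> norm ((U * V) *\<^sub>R case_prod (commutator_kernel \<eta>) p)"
      by (intro AE_I2) (auto simp: case_prod_unfold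
          intro: order_trans[OF _ mult_right_mono[OF abs_ge_self norm_ge_zero]])
  qed
  have inner_y: "(\<integral>y. F x y \<partial>lborel) = u x * (\<integral>y. commutator_kernel \<eta> x y * \<psi> y \<partial>lborel)" for x
    by (simp add: F_def mult.assoc)
  have inner_x: "(\<integral>x. F x y \<partial>lborel) = (\<integral>x. u x * commutator_kernel \<eta> x y \<partial>lborel) * \<psi> y" for y
    by (simp add: F_def)
  show "integrable lborel (\<lambda>x. u x * (\<integral>y. commutator_kernel \<eta> x y * \<psi> y \<partial>lborel))"
    using lborel_pair.integrable_fst[OF F] by (simp add: inner_y)
  show "(\<integral>x. u x * (\<integral>y. commutator_kernel \<eta> x y * \<psi> y \<partial>lborel) \<partial>lborel)
       = (\<integral>y. (\<integral>x. u x * commutator_kernel \<eta> x y \<partial>lborel) * \<psi> y \<partial>lborel)"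
    using lborel_pair.Fubini_integral[OF F] by (simp add: inner_y inner_x)
qed

lemma smooth_const: "smooth (\<lambda>_. c)"
  by (rule closed_under_derivative(2)[where S = "range (\<lambda>c _. c)"])
     (auto intro!: exI[of _ 0])

lemma smooth_translated_gauss: "smooth (\<lambda>x. complex_of_real (gauss (x - a)))"
proof -
  have "smooth (\<lambda>x. complex_of_real (exp (- a\<^sup>2 / 2)) * quadratic_exp (complex_of_real a) x)"
    using schwartz_quadratic_exp by (intro smooth_mult smooth_const) (simp add: schwartz_def)
  also have "(\<lambda>x. complex_of_real (exp (- a\<^sup>2 / 2)) * quadratic_exp (complex_of_real a) x)
      = (\<lambda>x. complex_of_real (gauss (x - a)))"
  proof
    fix x
    have "quadratic_exp (complex_of_real a) x = complex_of_real (exp (a * x - x\<^sup>2 / 2))"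
      by (simp add: quadratic_exp_def flip: exp_of_real)
    moreover have "exp (- a\<^sup>2 / 2) * exp (a * x - x\<^sup>2 / 2) = gauss (x - a)"
      unfolding gauss_def exp_add[symmetric] by (rule arg_cong[where f = exp]) (simp add: power2_diff field_simps)
    ultimately show "complex_of_real (exp (- a\<^sup>2 / 2)) * quadratic_exp (complex_of_real a) x
        = complex_of_real (gauss (x - a))"
      by (simp flip: of_real_mult)
  qed
  finally show ?thesis .
qed

lemma translated_gauss_transform_decay:
  "bounded (range (\<lambda>\<xi>. \<xi> ^ k *\<^sub>R fourier (\<lambda>x. complex_of_real (gauss (x - a))) \<xi>))"
proof -
  obtain C where C: "\<And>\<xi>. cmod (\<xi> ^ k *\<^sub>R quadratic_exp 0 \<xi>) \<le> C"
    using schwartz_rapid_decay[OF schwartz_quadratic_exp, of k 0] unfolding bounded_iff by auto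
  have "quadratic_exp 0 \<xi> = complex_of_real (gauss \<xi>)" for \<xi>
    using quadratic_exp_imaginary[of 0 \<xi>] by simp
  then have "cmod (\<xi> ^ k *\<^sub>R fourier (\<lambda>x. complex_of_real (gauss (x - a))) \<xi>)
      = sqrt (2 * pi) * cmod (\<xi> ^ k *\<^sub>R quadratic_exp 0 \<xi>)" for \<xi>
    by (simp add: fourier_translated_gauss norm_mult)
  then have "cmod (\<xi> ^ k *\<^sub>R fourier (\<lambda>x. complex_of_real (gauss (x - a))) \<xi>) \<le> sqrt (2 * pi) * C" for \<xi>
    using C[of \<xi>] by (simp only: mult_left_mono real_sqrt_ge_zero mult_nonneg_nonneg pi_ge_zero zero_le_numeral)
  then show ?thesis unfolding bounded_iff by blast
qed

text \<open>
  In the difference of the two singular integrals the numerator is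
  \<open>\<eta> x * \<psi> x - \<eta> (x + h) * \<psi> (x + h) - \<eta> x * (\<psi> x - \<psi> (x + h)) = (\<eta> x - \<eta> (x + h)) * \<psi> (x + h)\<close>.
\<close>

lemma commutator_with_multiplication:
  assumes \<eta>: "test_fun \<eta>" and smooth: "smooth \<psi>" and \<psi>: "integrable lborel \<psi>"
    and V: "\<And>x. cmod (\<psi> x) \<le> V"
    and decay: "\<And>k. bounded (range (\<lambda>\<xi>. \<xi> ^ k *\<^sub>R fourier \<psi> \<xi>))"
  shows "symbol_const * frac_laplacian (1/4) (\<lambda>x. \<eta> x * \<psi> x) x
       = \<eta> x * (symbol_const * frac_laplacian (1/4) \<psi> x)
         + (\<integral>y. commutator_kernel \<eta> x y * \<psi> y \<partial>lborel)"
proof -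
  have \<eta>\<psi>: "test_fun (\<lambda>x. \<eta> x * \<psi> x)"
    by (rule test_fun_mult[OF \<eta> smooth])
  obtain V' where V': "\<And>x. cmod (\<eta> x * \<psi> x) \<le> V'"
    using test_fun_bounded[OF \<eta>\<psi>, of 0 0] unfolding bounded_iff by auto
  have meas: "\<psi> \<in> borel_measurable borel" "(\<lambda>x. \<eta> x * \<psi> x) \<in> borel_measurable borel"
    using \<psi> test_fun_measurable[OF \<eta>\<psi>] by (auto dest: borel_measurable_integrable)
  have cont: "continuous_on UNIV \<psi>" "continuous_on UNIV (\<lambda>x. \<eta> x * \<psi> x)"
    using smooth_continuous[OF smooth, of UNIV 0] smooth_continuous[of "\<lambda>x. \<eta> x * \<psi> x" UNIV 0] \<eta>\<psi>
    by (simp_all add: test_fun_def)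
  have int_\<eta>\<psi>: "integrable lborel (\<lambda>x. \<eta> x * \<psi> x)"
    using test_fun_integrable[OF \<eta>\<psi>, of 0] by simp
  note \<psi>_formula = frac_laplacian_singular_integral[OF \<psi> cont(1) V
      rapid_decay_integrable[OF fourier_measurable[OF meas(1)] decay], of x]
  note \<eta>\<psi>_formula = frac_laplacian_singular_integral[OF int_\<eta>\<psi> cont(2) V'
      rapid_decay_integrable[OF fourier_measurable[OF meas(2)] test_fun_fourier_decay[OF \<eta>\<psi>]], of x]
  have "symbol_const * frac_laplacian (1/4) (\<lambda>x. \<eta> x * \<psi> x) x
        - \<eta> x * (symbol_const * frac_laplacian (1/4) \<psi> x)
      = (\<integral>h. hyper_kernel h *\<^sub>R (\<eta> x * \<psi> x - \<eta> (x + h) * \<psi> (x + h))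
            - \<eta> x * hyper_kernel h *\<^sub>R (\<psi> x - \<psi> (x + h)) \<partial>lborel)"
    unfolding \<psi>_formula(2) \<eta>\<psi>_formula(2)
    by (subst Bochner_Integration.integral_diff[OF \<eta>\<psi>_formula(1) integrable_mult_right[OF \<psi>_formula(1)]])
       (simp only: integral_mult_right_zero)
  also have "\<dots> = (\<integral>h. commutator_kernel \<eta> x (x + h) * \<psi> (x + h) \<partial>lborel)"
    by (intro Bochner_Integration.integral_cong refl)
       (simp add: commutator_kernel_def algebra_simps)
  also have "\<dots> = (\<integral>y. commutator_kernel \<eta> x y * \<psi> y \<partial>lborel)"
    by (subst (2) lborel_integral_real_affine[of 1 _ x]) simp_all
  finally show ?thesis by (simp add: algebra_simps)
qed

section \<open>The localised equation\<close>

lemma test_fun_mult_L2_loc: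
  assumes \<eta>: "test_fun \<eta>" and f: "in_L2_loc f"
  shows "integrable lborel (\<lambda>x. \<eta> x * f x)" and "integrable lborel (\<lambda>x. (cmod (\<eta> x * f x))\<^sup>2)"
proof -
  have [measurable]: "f \<in> borel_measurable borel" "\<eta> \<in> borel_measurable borel"
    using f test_fun_measurable[OF \<eta>] by (simp_all add: in_L2_loc_def)
  obtain R where R: "\<And>n x. \<bar>x\<bar> > R \<Longrightarrow> nth_deriv n \<eta> x = 0"
    using test_fun_support[OF \<eta>] by metis
  obtain B where B: "\<And>x. cmod (\<eta> x) \<le> B"
    using test_fun_bounded[OF \<eta>, of 0 0] unfolding bounded_iff by auto
  have "B \<ge> 0" using order_trans[OF norm_ge_zero B] .
  have f2: "integrable lborel (\<lambda>x. indicator {-R..R} x * (cmod (f x))\<^sup>2)"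
    using f unfolding in_L2_loc_def set_integrable_def by simp
  have one: "integrable lborel (\<lambda>x. indicator {-R..R} x :: real)"
    by (simp add: integrable_real_indicator emeasure_lborel_Icc_eq)
  have outside: "\<eta> x = 0" if "x \<notin> {-R..R}" for x
    using R[of x 0] that by force
  show "integrable lborel (\<lambda>x. (cmod (\<eta> x * f x))\<^sup>2)"
  proof (rule Bochner_Integration.integrable_bound)
    show "integrable lborel (\<lambda>x. B\<^sup>2 * (indicator {-R..R} x * (cmod (f x))\<^sup>2))"
      using f2 by (rule integrable_mult_right)
    have "(cmod (\<eta> x * f x))\<^sup>2 \<le> B\<^sup>2 * (indicator {-R..R} x * (cmod (f x))\<^sup>2)" for x
      using B[of x] outside[of x]
      by (cases "x \<in> {-R..R}") (simp_all add: norm_mult power_mult_distrib mult_right_mono power_mono)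
    then show "AE x in lborel. norm ((cmod (\<eta> x * f x))\<^sup>2)
        \<le> norm (B\<^sup>2 * (indicator {-R..R} x * (cmod (f x))\<^sup>2))"
      by (intro AE_I2) (simp add: order_trans[OF _ abs_ge_self])
  qed measurable
  show "integrable lborel (\<lambda>x. \<eta> x * f x)"
  proof (rule Bochner_Integration.integrable_bound)
    show "integrable lborel (\<lambda>x. B * (indicator {-R..R} x + indicator {-R..R} x * (cmod (f x))\<^sup>2))"
      by (intro integrable_mult_right Bochner_Integration.integrable_add one f2)
    have "cmod (\<eta> x * f x) \<le> B * (indicator {-R..R} x + indicator {-R..R} x * (cmod (f x))\<^sup>2)" for x
    proof (cases "x \<in> {-R..R}")
      case True
      have "2 * cmod (f x) \<le> 1 + (cmod (f x))\<^sup>2"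
        using zero_le_power2[of "cmod (f x) - 1"] by (simp add: power2_diff)
      then have "cmod (f x) \<le> 1 + (cmod (f x))\<^sup>2"
        using norm_ge_zero[of "f x"] by linarith
      then have "cmod (\<eta> x) * cmod (f x) \<le> B * (1 + (cmod (f x))\<^sup>2)"
        using B[of x] \<open>B \<ge> 0\<close> by (intro mult_mono) auto
      then show ?thesis using True by (simp add: norm_mult)
    qed (simp add: outside)
    then show "AE x in lborel. norm (\<eta> x * f x)
        \<le> norm (B * (indicator {-R..R} x + indicator {-R..R} x * (cmod (f x))\<^sup>2))"
      by (intro AE_I2) (simp add: order_trans[OF _ abs_ge_self])
  qed measurable
qed

text \<open>
  In the proof \<open>D\<close> is the difference of the two sides, multiplied by \<open>gauss\<close>. Pairing the equation with
  the Gaussian centred at \<open>a\<close> shows that the Fourier transform of \<open>D\<close> vanishes at \<open>a\<close>. The argument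
  is \<open>- \<xi>\<close> because pairings without complex conjugation reflect the frequency.
\<close>

lemma localised_equation:
  assumes \<eta>: "test_fun \<eta>" and f: "in_L2_loc f"
    and u [measurable]: "u \<in> borel_measurable borel" and U: "\<And>x. cmod (u x) \<le> U"
    and eq: "eq_tempered (frac_laplacian_distr (1/4) u) f"
  defines "h \<equiv> \<lambda>y. symbol_const * (\<eta> y * f y) - (\<integral>x. u x * commutator_kernel \<eta> x y \<partial>lborel)"
  shows "AE \<xi> in lborel. symbol_const * (complex_of_real (\<bar>\<xi>\<bar> powr (1/2)) * fourier (\<lambda>x. \<eta> x * u x) (- \<xi>))
       = fourier h (- \<xi>)"
proof -
  note test_fun_measurable[OF \<eta>, measurable]
  define v where "v x = \<eta> x * u x" for x
  define E where "E y = (\<integral>x. u x * commutator_kernel \<eta> x y \<partial>lborel)" for y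
  have E: "integrable lborel E"
    unfolding E_def[abs_def] using commutator_adjoint_bounded[OF \<eta>] u U by metis
  note \<eta>f = test_fun_mult_L2_loc[OF \<eta> f]
  have h: "integrable lborel h"
    unfolding h_def E_def[symmetric] using \<eta>f(1) E by simp
  have v: "integrable lborel v"
    unfolding v_def[abs_def] using test_fun_integrable[OF \<eta>, of 0] by (intro integrable_mult_bounded[OF _ u U]) simp
  define W where "W \<xi> = complex_of_real (\<bar>\<xi>\<bar> powr (1/2))" for \<xi>
  define D where "D \<xi> = (symbol_const * (W \<xi> * fourier v (- \<xi>)) - fourier h (- \<xi>)) * complex_of_real (gauss \<xi>)" for \<xi>
  have [measurable]: "W \<in> borel_measurable borel" "fourier v \<in> borel_measurable borel"
    "fourier h \<in> borel_measurable borel"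
    using v h by (auto simp: W_def[abs_def] dest: borel_measurable_integrable)
  have gauss_a: "fourier (\<lambda>x. complex_of_real (gauss (x - a))) \<in> borel_measurable borel" for a
    by measurable
  note transform_int = rapid_decay_integrable[OF gauss_a translated_gauss_transform_decay, folded W_def]
  have weak: "(\<integral>\<xi>. cis (- (\<xi> * a)) * D \<xi> \<partial>lborel) = 0" for a
  proof -
    define \<psi> where "\<psi> x = complex_of_real (gauss (x - a))" for x
    have \<psi>_int: "integrable lborel \<psi>"
      using lborel_integrable_real_affine[OF integrable_gauss, of 1 "- a"] by (simp add: \<psi>_def[abs_def])
    have \<psi>_le: "cmod (\<psi> x) \<le> 1" for x
      using gauss_pos[of "x - a"] gauss_le_1[of "x - a"] by (simp add: \<psi>_def)
    have \<psi>_meas [measurable]: "\<psi> \<in> borel_measurable borel"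
      using \<psi>_int by (auto dest: borel_measurable_integrable)
    have smooth: "smooth \<psi>"
      unfolding \<psi>_def[abs_def] by (rule smooth_translated_gauss)
    note f\<psi>_int = transform_int[of a, folded \<psi>_def]
    define \<Lambda> where "\<Lambda> = frac_laplacian (1/4) \<psi>"
    define K where "K x = (\<integral>y. commutator_kernel \<eta> x y * \<psi> y \<partial>lborel)" for x
    have \<Lambda>_eq: "\<Lambda> = inv_fourier (\<lambda>\<xi>. W \<xi> * fourier \<psi> \<xi>)"
      by (simp add: \<Lambda>_def frac_laplacian_def W_def)
    have comm: "symbol_const * frac_laplacian (1/4) (\<lambda>x. \<eta> x * \<psi> x) x
        = \<eta> x * (symbol_const * \<Lambda> x) + K x" for x
      unfolding \<Lambda>_def K_def
      using commutator_with_multiplication[OF \<eta> smooth \<psi>_int \<psi>_le]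
        translated_gauss_transform_decay[of _ a, folded \<psi>_def] by blast
    note pairing = commutator_pairing[OF \<eta> u U \<psi>_meas \<psi>_le, folded K_def E_def]
    have v\<Lambda>: "integrable lborel (\<lambda>x. v x * \<Lambda> x)"
    proof (rule integrable_mult_bounded[OF v])
      have [measurable]: "fourier (\<lambda>\<xi>. W \<xi> * fourier \<psi> \<xi>) \<in> borel_measurable borel"
        by measurable
      show "\<Lambda> \<in> borel_measurable borel"
        unfolding \<Lambda>_eq inv_fourier_eq_fourier[abs_def] by measurable
      show "cmod (\<Lambda> x) \<le> (\<integral>\<xi>. cmod (W \<xi> * fourier \<psi> \<xi>) \<partial>lborel) / (2 * pi)" for x
        unfolding \<Lambda>_eq inv_fourier_eq_fourier
        using fourier_bounded[of "\<lambda>\<xi>. W \<xi> * fourier \<psi> \<xi>" "- x"] by (simp add: norm_divide divide_right_mono)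
    qed
    have f\<eta>\<psi>: "integrable lborel (\<lambda>x. \<eta> x * f x * \<psi> x)"
      by (rule integrable_mult_bounded[OF \<eta>f(1) \<psi>_meas \<psi>_le])
    have "frac_laplacian_distr (1/4) u (\<lambda>x. \<eta> x * \<psi> x) = (\<integral>x. f x * (\<eta> x * \<psi> x) \<partial>lborel)"
      using eq f\<eta>\<psi> test_fun_imp_schwartz[OF test_fun_mult[OF \<eta> smooth]]
      unfolding eq_tempered_def by (simp add: mult_ac)
    then have "symbol_const * (\<integral>x. \<eta> x * f x * \<psi> x \<partial>lborel)
        = (\<integral>x. u x * (symbol_const * frac_laplacian (1/4) (\<lambda>x. \<eta> x * \<psi> x) x) \<partial>lborel)"
      by (simp add: frac_laplacian_distr_def mult_ac)
    \<comment> \<open>Moving \<open>\<eta>\<close> out of the operator costs the commutator \<open>K\<close>, which then passes to \<open>u\<close>.\<close>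
    also have "\<dots> = (\<integral>x. symbol_const * (v x * \<Lambda> x) + u x * K x \<partial>lborel)"
      by (intro Bochner_Integration.integral_cong refl) (simp add: comm v_def algebra_simps)
    also have "\<dots> = symbol_const * (\<integral>x. v x * \<Lambda> x \<partial>lborel) + (\<integral>y. E y * \<psi> y \<partial>lborel)"
      using v\<Lambda> pairing by simp
    finally have "symbol_const * (\<integral>x. v x * \<Lambda> x \<partial>lborel)
        = symbol_const * (\<integral>x. \<eta> x * f x * \<psi> x \<partial>lborel) - (\<integral>y. E y * \<psi> y \<partial>lborel)"
      by simp
    also have "\<dots> = (\<integral>y. symbol_const * (\<eta> y * f y * \<psi> y) - E y * \<psi> y \<partial>lborel)"
      using f\<eta>\<psi> integrable_mult_bounded[OF E \<psi>_meas \<psi>_le] by simp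
    also have "\<dots> = (\<integral>y. h y * \<psi> y \<partial>lborel)"
      by (simp add: h_def E_def algebra_simps)
    also have "\<dots> = (\<integral>y. h y * inv_fourier (fourier \<psi>) y \<partial>lborel)"
      using fourier_inversion[OF \<psi>_int _ \<psi>_le f\<psi>_int(1)] smooth_continuous[OF smooth, of UNIV 0] by simp
    finally have "symbol_const * (\<integral>\<xi>. fourier v (- \<xi>) * (W \<xi> * fourier \<psi> \<xi>) \<partial>lborel)
        = (\<integral>\<xi>. fourier h (- \<xi>) * fourier \<psi> \<xi> \<partial>lborel)"
      unfolding \<Lambda>_eq by (simp add: inv_fourier_duality[OF v f\<psi>_int(2)] inv_fourier_duality[OF h f\<psi>_int(1)])
    moreover have "integrable lborel (\<lambda>\<xi>. fourier v (- \<xi>) * (W \<xi> * fourier \<psi> \<xi>))"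
      using integrable_mult_bounded[OF f\<psi>_int(2) _ fourier_bounded[of v]] by (simp add: mult.commute)
    moreover have "integrable lborel (\<lambda>\<xi>. fourier h (- \<xi>) * fourier \<psi> \<xi>)"
      using integrable_mult_bounded[OF f\<psi>_int(1) _ fourier_bounded[of h]] by (simp add: mult.commute)
    ultimately have "(\<integral>\<xi>. symbol_const * (fourier v (- \<xi>) * (W \<xi> * fourier \<psi> \<xi>)) - fourier h (- \<xi>) * fourier \<psi> \<xi> \<partial>lborel) = 0"
      by simp
    also have "(\<lambda>\<xi>. symbol_const * (fourier v (- \<xi>) * (W \<xi> * fourier \<psi> \<xi>)) - fourier h (- \<xi>) * fourier \<psi> \<xi>)
        = (\<lambda>\<xi>. complex_of_real (sqrt (2 * pi)) * (cis (- (\<xi> * a)) * D \<xi>))"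
      unfolding \<psi>_def by (intro ext) (simp only: fourier_translated_gauss D_def, simp only: algebra_simps)
    finally show ?thesis by simp
  qed
  have "AE \<xi> in lborel. D \<xi> = 0"
  proof (rule fourier_injective)
    show "fourier D a = 0" for a
      using weak[of a] by (simp add: fourier_def)
    have g: "integrable lborel (\<lambda>\<xi>. complex_of_real (gauss \<xi>))" "integrable lborel (\<lambda>\<xi>. W \<xi> * complex_of_real (gauss \<xi>))"
    proof -
      have cancel: "integrable lborel g"
        if "integrable lborel (\<lambda>\<xi>. complex_of_real (sqrt (2 * pi)) * g \<xi>)" for g
        using integrable_mult_right[OF that, of "1 / complex_of_real (sqrt (2 * pi))"] by simp
      show "integrable lborel (\<lambda>\<xi>. complex_of_real (gauss \<xi>))"
        using transform_int(1)[of 0] unfolding fourier_translated_gauss[abs_def]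
        by - (rule cancel, simp)
      show "integrable lborel (\<lambda>\<xi>. W \<xi> * complex_of_real (gauss \<xi>))"
        using transform_int(2)[of 0] unfolding fourier_translated_gauss[abs_def]
        by - (rule cancel, simp add: mult.left_commute[of "W _"])
    qed
    have "integrable lborel (\<lambda>\<xi>. symbol_const * (W \<xi> * complex_of_real (gauss \<xi>) * fourier v (- \<xi>))
        - complex_of_real (gauss \<xi>) * fourier h (- \<xi>))"
      by (intro Bochner_Integration.integrable_diff integrable_mult_right
          integrable_mult_bounded[OF g(1) _ fourier_bounded] integrable_mult_bounded[OF g(2) _ fourier_bounded]) measurable
    then show "integrable lborel D"
      by (simp add: D_def[abs_def] algebra_simps)
  qed
  then show ?thesis
  proof eventually_elim
    case (elim \<xi>)
    then show ?case
      using gauss_pos[of \<xi>] by (simp add: D_def W_def v_def[abs_def])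
  qed
qed

section \<open>The estimate\<close>

lemma esssup_nonneg: "esssup lborel (\<lambda>x::real. ereal (cmod (v x))) \<ge> 0"
proof (cases "(\<lambda>x. ereal (cmod (v x))) \<in> borel_measurable lborel")
  case True
  have "esssup lborel (\<lambda>x::real. 0 :: ereal) \<le> esssup lborel (\<lambda>x. ereal (cmod (v x)))"
    by (intro esssup_mono) auto
  then show ?thesis by (subst (asm) esssup_const) auto
qed (simp add: esssup_non_measurable)

lemma Linf_norm_nonneg: "Linf_norm v \<ge> 0"
  unfolding Linf_norm_def using esssup_nonneg by (rule real_of_ereal_pos)

lemma AE_le_Linf_norm:
  assumes "in_Linf v"
  shows "AE x in lborel. cmod (v x) \<le> Linf_norm v"
proof -
  define s where "s = esssup lborel (\<lambda>x. ereal (cmod (v x)))"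
  have "s < \<infinity>" using assms by (simp add: in_Linf_def s_def)
  moreover have "s \<ge> 0" unfolding s_def by (rule esssup_nonneg)
  ultimately have s: "s = ereal (Linf_norm v)"
    unfolding Linf_norm_def s_def[symmetric] by (cases s) auto
  have "AE x in lborel. ereal (cmod (v x)) \<le> s"
    unfolding s_def by (rule esssup_AE)
  then show ?thesis by (simp add: s)
qed

lemma bounded_imp_in_L2_loc:
  assumes [measurable]: "u \<in> borel_measurable borel" and U: "\<And>x. cmod (u x) \<le> U"
  shows "in_L2_loc u"
  unfolding in_L2_loc_def set_integrable_def
proof (intro conjI allI impI)
  fix K :: "real set" assume "compact K"
  have "K \<in> sets borel"
    using compact_imp_closed[OF \<open>compact K\<close>] by (rule borel_closed)
  moreover have "emeasure lborel K < \<infinity>"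
    using compact_imp_bounded[OF \<open>compact K\<close>] by (rule emeasure_bounded_finite)
  moreover have "(cmod (u x))\<^sup>2 \<le> U\<^sup>2" for x
    by (intro power_mono U) simp
  ultimately show "integrable lborel (\<lambda>x. indicator K x *\<^sub>R (cmod (u x))\<^sup>2)"
    by (intro integrableI_bounded_set_indicator[where B = "U\<^sup>2"]) auto
qed simp

text \<open>
  The weight \<open>(1 + \<xi>\<^sup>2) powr (1/2)\<close> is at most \<open>1 + \<bar>\<xi>\<bar>\<close>. The term \<open>1\<close> is controlled by the \<open>L\<^sup>2\<close> norm
  of \<open>\<eta> u\<close>. The term \<open>\<bar>\<xi>\<bar>\<close> is controlled by the \<open>L\<^sup>2\<close> norm of the right side of the localised equation.
\<close>

lemma localised_fourier_bound:
  assumes \<eta>: "test_fun \<eta>"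
  obtains C where "C \<ge> 0"
    "\<And>u f U. \<lbrakk>in_L2_loc f; u \<in> borel_measurable borel; \<And>x. cmod (u x) \<le> U;
        eq_tempered (frac_laplacian_distr (1/4) u) f\<rbrakk> \<Longrightarrow>
      integrable lborel (\<lambda>\<xi>. (1 + \<xi>\<^sup>2) powr (1/2) * (cmod (fourier (\<lambda>x. \<eta> x * u x) \<xi>))\<^sup>2) \<and>
      (\<integral>\<xi>. (1 + \<xi>\<^sup>2) powr (1/2) * (cmod (fourier (\<lambda>x. \<eta> x * u x) \<xi>))\<^sup>2 \<partial>lborel)
        \<le> 2 * pi * (2 * (\<integral>x. (cmod (\<eta> x * f x))\<^sup>2 \<partial>lborel) + C * U\<^sup>2)"
proof -
  note test_fun_measurable[OF \<eta>, measurable]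
  obtain N where "N \<ge> 0" and N:
    "\<And>u U. \<lbrakk>u \<in> borel_measurable borel; \<And>x. cmod (u x) \<le> U\<rbrakk> \<Longrightarrow>
       integrable lborel (\<lambda>y. \<integral>x. u x * commutator_kernel \<eta> x y \<partial>lborel) \<and>
       integrable lborel (\<lambda>y. (cmod (\<integral>x. u x * commutator_kernel \<eta> x y \<partial>lborel))\<^sup>2) \<and>
       (\<integral>y. (cmod (\<integral>x. u x * commutator_kernel \<eta> x y \<partial>lborel))\<^sup>2 \<partial>lborel) \<le> N * U\<^sup>2"
    by (rule commutator_adjoint_bounded[OF \<eta>]) blast
  define A where "A = cmod symbol_const"
  have "A > 0" using symbol_const_nonzero by (simp add: A_def)
  have \<eta>_int: "integrable lborel \<eta>" using test_fun_integrable[OF \<eta>, of 0] by simp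
  have \<eta>_sq: "integrable lborel (\<lambda>x. (cmod (\<eta> x))\<^sup>2)"
    using test_fun_mult_L2_loc(2)[OF \<eta> bounded_imp_in_L2_loc[of "\<lambda>_. 1" 1]] by simp
  define N\<eta> where "N\<eta> = (\<integral>x. (cmod (\<eta> x))\<^sup>2 \<partial>lborel)"
  \<comment> \<open>\<open>N\<eta>\<close> is the share of the low frequencies, \<open>2 * N / A\<^sup>2\<close> that of the commutator.\<close>
  define C where "C = N\<eta> + 2 * N / A\<^sup>2"
  have "C \<ge> 0" using \<open>N \<ge> 0\<close> by (simp add: C_def N\<eta>_def)
  moreover have
    "integrable lborel (\<lambda>\<xi>. (1 + \<xi>\<^sup>2) powr (1/2) * (cmod (fourier (\<lambda>x. \<eta> x * u x) \<xi>))\<^sup>2) \<and>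
     (\<integral>\<xi>. (1 + \<xi>\<^sup>2) powr (1/2) * (cmod (fourier (\<lambda>x. \<eta> x * u x) \<xi>))\<^sup>2 \<partial>lborel)
       \<le> 2 * pi * (2 * (\<integral>x. (cmod (\<eta> x * f x))\<^sup>2 \<partial>lborel) + C * U\<^sup>2)"
    if f: "in_L2_loc f" and u [measurable]: "u \<in> borel_measurable borel" and U: "\<And>x. cmod (u x) \<le> U"
      and eq: "eq_tempered (frac_laplacian_distr (1/4) u) f" for u f U
  proof -
    define v where "v x = \<eta> x * u x" for x
    define E where "E y = (\<integral>x. u x * commutator_kernel \<eta> x y \<partial>lborel)" for y
    define h where "h y = symbol_const * (\<eta> y * f y) - E y" for y
    define Nf where "Nf = (\<integral>x. (cmod (\<eta> x * f x))\<^sup>2 \<partial>lborel)"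
    note E = N[OF u U, folded E_def]
    note \<eta>f = test_fun_mult_L2_loc[OF \<eta> f]
    have "U \<ge> 0" using order_trans[OF norm_ge_zero U] .
    have v: "integrable lborel v"
      unfolding v_def[abs_def] by (rule integrable_mult_bounded[OF \<eta>_int u U])
    have [measurable]: "v \<in> borel_measurable borel"
      using v by (auto dest: borel_measurable_integrable)
    have v_le: "(cmod (v x))\<^sup>2 \<le> (cmod (\<eta> x))\<^sup>2 * U\<^sup>2" for x
      unfolding v_def norm_mult power_mult_distrib by (intro mult_left_mono power_mono U) auto
    have v_sq: "integrable lborel (\<lambda>x. (cmod (v x))\<^sup>2)"
    proof (rule Bochner_Integration.integrable_bound)
      show "integrable lborel (\<lambda>x. (cmod (\<eta> x))\<^sup>2 * U\<^sup>2)" using \<eta>_sq by simp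
      show "AE x in lborel. norm ((cmod (v x))\<^sup>2) \<le> norm ((cmod (\<eta> x))\<^sup>2 * U\<^sup>2)"
        using v_le by (intro AE_I2) simp
    qed measurable
    have v_norm: "(\<integral>x. (cmod (v x))\<^sup>2 \<partial>lborel) \<le> N\<eta> * U\<^sup>2"
    proof -
      have "(\<integral>x. (cmod (v x))\<^sup>2 \<partial>lborel) \<le> (\<integral>x. (cmod (\<eta> x))\<^sup>2 * U\<^sup>2 \<partial>lborel)"
        using \<eta>_sq by (intro integral_mono v_sq v_le) simp
      then show ?thesis by (simp add: N\<eta>_def)
    qed
    have h: "integrable lborel h"
      unfolding h_def[abs_def] using \<eta>f(1) E by simp
    have [measurable]: "h \<in> borel_measurable borel"
      using h by (auto dest: borel_measurable_integrable)
    have h_le: "(cmod (h y))\<^sup>2 \<le> 2 * A\<^sup>2 * (cmod (\<eta> y * f y))\<^sup>2 + 2 * (cmod (E y))\<^sup>2" for y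
    proof -
      have "(cmod (h y))\<^sup>2 \<le> (A * cmod (\<eta> y * f y) + cmod (E y))\<^sup>2"
        unfolding h_def A_def norm_mult[symmetric] by (intro power_mono norm_triangle_ineq4) simp
      also have "\<dots> \<le> 2 * (A * cmod (\<eta> y * f y))\<^sup>2 + 2 * (cmod (E y))\<^sup>2"
        using sum_squares_bound[of "A * cmod (\<eta> y * f y)" "cmod (E y)"] by (simp add: power2_sum)
      finally show ?thesis by (simp add: power_mult_distrib)
    qed
    have h_dom: "integrable lborel (\<lambda>y. 2 * A\<^sup>2 * (cmod (\<eta> y * f y))\<^sup>2 + 2 * (cmod (E y))\<^sup>2)"
      using \<eta>f(2) E by (intro Bochner_Integration.integrable_add integrable_mult_right) auto
    have h_sq: "integrable lborel (\<lambda>y. (cmod (h y))\<^sup>2)"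
    proof (rule Bochner_Integration.integrable_bound[OF h_dom])
      show "AE y in lborel. norm ((cmod (h y))\<^sup>2) \<le> norm (2 * A\<^sup>2 * (cmod (\<eta> y * f y))\<^sup>2 + 2 * (cmod (E y))\<^sup>2)"
        using h_le by (intro AE_I2) (simp add: order_trans[OF _ abs_ge_self])
    qed measurable
    have h_norm: "(\<integral>y. (cmod (h y))\<^sup>2 \<partial>lborel) \<le> 2 * A\<^sup>2 * Nf + 2 * (N * U\<^sup>2)"
    proof -
      have "(\<integral>y. (cmod (h y))\<^sup>2 \<partial>lborel)
          \<le> (\<integral>y. 2 * A\<^sup>2 * (cmod (\<eta> y * f y))\<^sup>2 + 2 * (cmod (E y))\<^sup>2 \<partial>lborel)"
        by (intro integral_mono h_sq h_dom h_le)
      also have "\<dots> = 2 * A\<^sup>2 * Nf + 2 * (\<integral>y. (cmod (E y))\<^sup>2 \<partial>lborel)"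
        unfolding Nf_def using \<eta>f(2) E by (subst Bochner_Integration.integral_add) simp_all
      finally show ?thesis using E by linarith
    qed
    have "AE \<xi> in lborel. symbol_const * (complex_of_real (\<bar>\<xi>\<bar> powr (1/2)) * fourier v (- \<xi>)) = fourier h (- \<xi>)"
      using localised_equation[OF \<eta> f u U eq] unfolding v_def[symmetric] E_def[symmetric] h_def[symmetric] .
    then have AE_eq: "AE \<xi> in lborel. (cmod (fourier h (- \<xi>)))\<^sup>2 / A\<^sup>2 = \<bar>\<xi>\<bar> * (cmod (fourier v (- \<xi>)))\<^sup>2"
    proof eventually_elim
      case (elim \<xi>)
      have "(cmod (fourier h (- \<xi>)))\<^sup>2 = A\<^sup>2 * ((\<bar>\<xi>\<bar> powr (1/2))\<^sup>2 * (cmod (fourier v (- \<xi>)))\<^sup>2)"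
        unfolding elim[symmetric] by (simp add: norm_mult power_mult_distrib A_def)
      also have "(\<bar>\<xi>\<bar> powr (1/2))\<^sup>2 = \<bar>\<xi>\<bar>" by (simp add: powr_half_sqrt)
      finally show ?case using \<open>A > 0\<close> by (simp add: field_simps)
    qed
    have [measurable]: "fourier v \<in> borel_measurable borel" "fourier h \<in> borel_measurable borel"
      by measurable
    have "integrable lborel (\<lambda>\<xi>. (cmod (fourier h (- \<xi>)))\<^sup>2 / A\<^sup>2)"
      using lborel_integrable_real_affine[OF bessel_inequality(1)[OF h h_sq], of "-1" 0] by simp
    then have refl_int: "integrable lborel (\<lambda>\<xi>. \<bar>\<xi>\<bar> * (cmod (fourier v (- \<xi>)))\<^sup>2)"
      by (rule integrable_cong_AE_imp[OF _ _ AE_eq]) measurable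
    have "(\<integral>\<xi>. \<bar>\<xi>\<bar> * (cmod (fourier v (- \<xi>)))\<^sup>2 \<partial>lborel) = (\<integral>\<xi>. (cmod (fourier h (- \<xi>)))\<^sup>2 / A\<^sup>2 \<partial>lborel)"
      by (rule integral_cong_AE[OF _ _ AE_eq, symmetric]) measurable
    also have "\<dots> = (\<integral>\<xi>. (cmod (fourier h \<xi>))\<^sup>2 \<partial>lborel) / A\<^sup>2"
      using lborel_integral_real_affine[of "-1" "\<lambda>\<xi>. (cmod (fourier h \<xi>))\<^sup>2" 0] by simp
    finally have refl_eq: "(\<integral>\<xi>. \<bar>\<xi>\<bar> * (cmod (fourier v (- \<xi>)))\<^sup>2 \<partial>lborel) = (\<integral>\<xi>. (cmod (fourier h \<xi>))\<^sup>2 \<partial>lborel) / A\<^sup>2" .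
    have high_int: "integrable lborel (\<lambda>\<xi>. \<bar>\<xi>\<bar> * (cmod (fourier v \<xi>))\<^sup>2)"
      using lborel_integrable_real_affine[OF refl_int, of "-1" 0] by simp
    have "(\<integral>\<xi>. \<bar>\<xi>\<bar> * (cmod (fourier v \<xi>))\<^sup>2 \<partial>lborel) = (\<integral>\<xi>. (cmod (fourier h \<xi>))\<^sup>2 \<partial>lborel) / A\<^sup>2"
      using lborel_integral_real_affine[of "-1" "\<lambda>\<xi>. \<bar>\<xi>\<bar> * (cmod (fourier v \<xi>))\<^sup>2" 0] refl_eq by simp
    also have "\<dots> \<le> 2 * pi * (2 * A\<^sup>2 * Nf + 2 * (N * U\<^sup>2)) / A\<^sup>2"
      using order_trans[OF bessel_inequality(2)[OF h h_sq] mult_left_mono[OF h_norm]]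
      by (intro divide_right_mono) auto
    also have "\<dots> = 2 * pi * (2 * Nf + 2 * N / A\<^sup>2 * U\<^sup>2)"
      using \<open>A > 0\<close> by (simp add: field_simps)
    finally have high: "(\<integral>\<xi>. \<bar>\<xi>\<bar> * (cmod (fourier v \<xi>))\<^sup>2 \<partial>lborel) \<le> 2 * pi * (2 * Nf + 2 * N / A\<^sup>2 * U\<^sup>2)" .
    have low: "(\<integral>\<xi>. (cmod (fourier v \<xi>))\<^sup>2 \<partial>lborel) \<le> 2 * pi * (N\<eta> * U\<^sup>2)"
      using order_trans[OF bessel_inequality(2)[OF v v_sq] mult_left_mono[OF v_norm]] by simp
    have weight: "(1 + \<xi>\<^sup>2) powr (1/2) \<le> 1 + \<bar>\<xi>\<bar>" for \<xi> :: real
    proof -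
      have "sqrt (1 + \<xi>\<^sup>2) \<le> 1 + \<bar>\<xi>\<bar>"
        by (rule real_le_lsqrt) (simp_all add: power2_sum)
      then show ?thesis by (simp add: powr_half_sqrt)
    qed
    define F where "F \<xi> = (1 + \<xi>\<^sup>2) powr (1/2) * (cmod (fourier v \<xi>))\<^sup>2" for \<xi>
    have [measurable]: "F \<in> borel_measurable borel"
      unfolding F_def[abs_def] by measurable
    have F_le: "F \<xi> \<le> (cmod (fourier v \<xi>))\<^sup>2 + \<bar>\<xi>\<bar> * (cmod (fourier v \<xi>))\<^sup>2" for \<xi>
      unfolding F_def using mult_right_mono[OF weight[of \<xi>], of "(cmod (fourier v \<xi>))\<^sup>2"] by (simp add: distrib_right)
    have dom: "integrable lborel (\<lambda>\<xi>. (cmod (fourier v \<xi>))\<^sup>2 + \<bar>\<xi>\<bar> * (cmod (fourier v \<xi>))\<^sup>2)"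
      by (intro Bochner_Integration.integrable_add bessel_inequality(1)[OF v v_sq] high_int)
    have F_int: "integrable lborel F"
    proof (rule Bochner_Integration.integrable_bound[OF dom])
      show "AE \<xi> in lborel. norm (F \<xi>) \<le> norm ((cmod (fourier v \<xi>))\<^sup>2 + \<bar>\<xi>\<bar> * (cmod (fourier v \<xi>))\<^sup>2)"
        using F_le by (intro AE_I2) (simp add: F_def order_trans[OF _ abs_ge_self])
    qed measurable
    have "(\<integral>\<xi>. F \<xi> \<partial>lborel) \<le> (\<integral>\<xi>. (cmod (fourier v \<xi>))\<^sup>2 + \<bar>\<xi>\<bar> * (cmod (fourier v \<xi>))\<^sup>2 \<partial>lborel)"
      by (intro integral_mono F_int dom F_le)
    also have "\<dots> = (\<integral>\<xi>. (cmod (fourier v \<xi>))\<^sup>2 \<partial>lborel) + (\<integral>\<xi>. \<bar>\<xi>\<bar> * (cmod (fourier v \<xi>))\<^sup>2 \<partial>lborel)"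
      by (rule Bochner_Integration.integral_add[OF bessel_inequality(1)[OF v v_sq] high_int])
    also have "\<dots> \<le> 2 * pi * (N\<eta> * U\<^sup>2) + 2 * pi * (2 * Nf + 2 * N / A\<^sup>2 * U\<^sup>2)"
      by (intro add_mono low high)
    also have "\<dots> = 2 * pi * (2 * Nf + C * U\<^sup>2)"
      by (simp add: C_def algebra_simps)
    finally show ?thesis
      using F_int unfolding F_def[abs_def] v_def[abs_def] Nf_def by simp
  qed
  ultimately show ?thesis using that by blast
qed

text \<open>
  What remains is to pass from pointwise to essential bounds and from the integral formula for the
  transform to \<open>fourier_L2\<close>.
\<close>

lemma localised_H_half_bound:
  assumes \<eta>: "test_fun \<eta>"
  obtains C where "\<And>u f. \<lbrakk>in_Linf u; in_L2_loc f; eq_tempered (frac_laplacian_distr (1/4) u) f\<rbrakk> \<Longrightarrow>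
      in_H (1/2) (\<lambda>x. \<eta> x * u x) \<and>
      H_norm (1/2) (\<lambda>x. \<eta> x * u x) \<le> C * (L2_norm (\<lambda>x. \<eta> x * f x) + Linf_norm u)"
proof -
  note test_fun_measurable[OF \<eta>, measurable]
  obtain C where "C \<ge> 0" and C:
    "\<And>u f U. \<lbrakk>in_L2_loc f; u \<in> borel_measurable borel; \<And>x. cmod (u x) \<le> U;
        eq_tempered (frac_laplacian_distr (1/4) u) f\<rbrakk> \<Longrightarrow>
      integrable lborel (\<lambda>\<xi>. (1 + \<xi>\<^sup>2) powr (1/2) * (cmod (fourier (\<lambda>x. \<eta> x * u x) \<xi>))\<^sup>2) \<and>
      (\<integral>\<xi>. (1 + \<xi>\<^sup>2) powr (1/2) * (cmod (fourier (\<lambda>x. \<eta> x * u x) \<xi>))\<^sup>2 \<partial>lborel)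
        \<le> 2 * pi * (2 * (\<integral>x. (cmod (\<eta> x * f x))\<^sup>2 \<partial>lborel) + C * U\<^sup>2)"
    by (rule localised_fourier_bound[OF \<eta>]) blast
  have "in_H (1/2) (\<lambda>x. \<eta> x * u x) \<and>
      H_norm (1/2) (\<lambda>x. \<eta> x * u x) \<le> sqrt (2 + C) * (L2_norm (\<lambda>x. \<eta> x * f x) + Linf_norm u)"
    if u: "in_Linf u" and f: "in_L2_loc f" and eq: "eq_tempered (frac_laplacian_distr (1/4) u) f" for u f
  proof -
    have [measurable]: "u \<in> borel_measurable borel" using u by (simp add: in_Linf_def)
    define U where "U = Linf_norm u"
    \<comment> \<open>Truncation makes the essential bound of \<open>u\<close> hold everywhere and changes no integral.\<close>
    define u' where "u' x = (if cmod (u x) \<le> U then u x else 0)" for x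
    have "U \<ge> 0" unfolding U_def by (rule Linf_norm_nonneg)
    have u' [measurable]: "u' \<in> borel_measurable borel" unfolding u'_def[abs_def] by measurable
    have u'_le: "cmod (u' x) \<le> U" for x using \<open>U \<ge> 0\<close> by (simp add: u'_def)
    have AE_eq: "AE x in lborel. u' x = u x"
      using AE_le_Linf_norm[OF u] by eventually_elim (simp add: u'_def U_def)
    have "frac_laplacian_distr (1/4) u' \<phi> = frac_laplacian_distr (1/4) u \<phi>" if "schwartz \<phi>" for \<phi>
    proof -
      have [measurable]: "\<phi> \<in> borel_measurable borel" by (rule schwartz_measurable[OF that])
      have [measurable]: "fourier (\<lambda>\<xi>. complex_of_real (\<bar>\<xi>\<bar> powr (2 * (1/4))) * fourier \<phi> \<xi>) \<in> borel_measurable borel"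
        by measurable
      have [measurable]: "frac_laplacian (1/4) \<phi> \<in> borel_measurable borel"
        unfolding frac_laplacian_def inv_fourier_eq_fourier[abs_def] by measurable
      show ?thesis
        unfolding frac_laplacian_distr_def using AE_eq by (intro integral_cong_AE) auto
    qed
    then have eq': "eq_tempered (frac_laplacian_distr (1/4) u') f"
      using eq unfolding eq_tempered_def by simp
    note bound = C[OF f u' u'_le eq']
    define v where "v x = \<eta> x * u x" for x
    define v' where "v' x = \<eta> x * u' x" for x
    have [measurable]: "v \<in> borel_measurable borel" "v' \<in> borel_measurable borel"
      unfolding v_def[abs_def] v'_def[abs_def] by measurable
    have AE_v: "AE x in lborel. v' x = v x"
      using AE_eq by eventually_elim (simp add: v_def v'_def)
    have "integrable lborel v'"
      unfolding v'_def[abs_def] using test_fun_integrable[OF \<eta>, of 0]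
      by (intro integrable_mult_bounded[OF _ u' u'_le]) simp
    then have v: "integrable lborel v"
      by (rule integrable_cong_AE_imp[OF _ _ AE_v]) simp
    from test_fun_mult_L2_loc(2)[OF \<eta> bounded_imp_in_L2_loc[OF u' u'_le]] have "integrable lborel (\<lambda>x. (cmod (v' x))\<^sup>2)"
      by (simp add: v'_def)
    then have "integrable lborel (\<lambda>x. (cmod (v x))\<^sup>2)"
    proof (rule integrable_cong_AE_imp)
      show "AE x in lborel. (cmod (v' x))\<^sup>2 = (cmod (v x))\<^sup>2"
        using AE_v by eventually_elim simp
    qed simp
    then have L2: "in_L2 v" by (simp add: in_L2_def)
    have fv: "fourier v' = fourier v"
      unfolding fourier_def using AE_v by (intro ext integral_cong_AE) auto
    have [measurable]: "fourier_L2 v \<in> borel_measurable borel"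
      using fourier_L2_eq_fourier(2)[OF L2 v] by (simp add: in_L2_def)
    have AE_F: "AE \<xi> in lborel. (1 + \<xi>\<^sup>2) powr (1/2) * (cmod (fourier v' \<xi>))\<^sup>2
        = (1 + \<xi>\<^sup>2) powr (1/2) * (cmod (fourier_L2 v \<xi>))\<^sup>2"
      using fourier_L2_eq_fourier(1)[OF L2 v] by eventually_elim (simp add: fv)
    define I where "I = (\<integral>\<xi>. (1 + \<xi>\<^sup>2) powr (1/2) * (cmod (fourier_L2 v \<xi>))\<^sup>2 \<partial>lborel)"
    have int: "integrable lborel (\<lambda>\<xi>. (1 + \<xi>\<^sup>2) powr (1/2) * (cmod (fourier_L2 v \<xi>))\<^sup>2)"
      using bound AE_F unfolding v'_def[symmetric]
      by (intro integrable_cong_AE_imp[OF _ _ AE_F]) auto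
    have I_eq: "I = (\<integral>\<xi>. (1 + \<xi>\<^sup>2) powr (1/2) * (cmod (fourier v' \<xi>))\<^sup>2 \<partial>lborel)"
      unfolding I_def by (rule integral_cong_AE[OF _ _ AE_F, symmetric]) measurable
    define S where "S = L2_norm (\<lambda>x. \<eta> x * f x)"
    have "S \<ge> 0" by (simp add: S_def L2_norm_def)
    have S_sq: "(\<integral>x. (cmod (\<eta> x * f x))\<^sup>2 \<partial>lborel) = S\<^sup>2"
      by (simp add: S_def L2_norm_def)
    have "I \<le> 2 * pi * (2 * S\<^sup>2 + C * U\<^sup>2)"
      using bound unfolding I_eq S_sq[symmetric] v'_def by blast
    also have "\<dots> \<le> 2 * pi * ((2 + C) * (S + U)\<^sup>2)"
    proof (rule mult_left_mono)
      have "S\<^sup>2 \<le> (S + U)\<^sup>2" "U\<^sup>2 \<le> (S + U)\<^sup>2"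
        using \<open>S \<ge> 0\<close> \<open>U \<ge> 0\<close> by (auto intro!: power_mono)
      then have "2 * S\<^sup>2 + C * U\<^sup>2 \<le> 2 * (S + U)\<^sup>2 + C * (S + U)\<^sup>2"
        using \<open>C \<ge> 0\<close> by (intro add_mono mult_left_mono) auto
      then show "2 * S\<^sup>2 + C * U\<^sup>2 \<le> (2 + C) * (S + U)\<^sup>2"
        by (simp add: distrib_right)
    qed simp
    finally have "I / (2 * pi) \<le> (2 + C) * (S + U)\<^sup>2"
      by (simp add: divide_le_eq mult_ac)
    then have "sqrt (I / (2 * pi)) \<le> sqrt ((2 + C) * (S + U)\<^sup>2)"
      by (rule real_sqrt_le_mono)
    also have "\<dots> = sqrt (2 + C) * (S + U)"
      using \<open>S \<ge> 0\<close> \<open>U \<ge> 0\<close> by (simp add: real_sqrt_mult)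
    finally have "H_norm (1/2) v \<le> sqrt (2 + C) * (S + U)"
      by (simp add: H_norm_def I_def)
    moreover have "in_H (1/2) v"
      using L2 int by (simp add: in_H_def)
    ultimately show ?thesis
      by (simp add: v_def[abs_def] S_def U_def)
  qed
  then show ?thesis using that by blast
qed

theorem lemmaA3:
  "(\<forall>u f :: real \<Rightarrow> complex.
      in_Linf u \<longrightarrow> in_L2_loc f \<longrightarrow> eq_tempered (frac_laplacian_distr (1/4) u) f \<longrightarrow>
      in_H_loc (1/2) u) \<and>
   (\<forall>\<eta> :: real \<Rightarrow> complex. test_fun \<eta> \<longrightarrow>
      (\<exists>C :: real. \<forall>u f :: real \<Rightarrow> complex.
         in_Linf u \<longrightarrow> in_L2_loc f \<longrightarrow> eq_tempered (frac_laplacian_distr (1/4) u) f \<longrightarrow>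
         H_norm (1/2) (\<lambda>x. \<eta> x * u x)
           \<le> C * (L2_norm (\<lambda>x. \<eta> x * f x) + Linf_norm u)))"
  unfolding in_H_loc_def using localised_H_half_bound by meson

end
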